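(* Let $n \geq 1$ be an integer and let $\rho : G = \mathbb{Z}_2^n \to R$ be a function that fulfills Simon's promise for some subgroup $H_0 \leq G$, i.e. $\rho$ is constant on each coset of $H_0$ and takes distinct values on distinct cosets of $H_0$. Then, given a quantum polynomial-time (in $n$) algorithm to compute $\rho$ without making measurements, there exists a $\mathcal{QP}$-algorithm to find a generating set for $H_0$, that is, a quantum algorithm that runs in guaranteed worst-case time polynomial in $n$ and outputs, with zero error probability, a generating set for $H_0$.
   Context: $G$ denotes the additive group $\langle \mathbb{Z}_2^n, \oplus\rangle$, where $\oplus$ is the bitwise exclusive-or. $R$ is any set representable on a quantum computer (its elements are encoded as bit strings of a fixed length). The subgroup $H_0$ is not known to the algorithm; the algorithm is given $n$ and may use the given quantum algorithm for $\rho$ as a subroutine. Computing a function $f$ without measurements means implementing the unitary operation $\mathbf{U}_f : |x\rangle|y\rangle \mapsto |x\rangle|y \oplus f(x)\rangle$ by a measurement-free quantum circuit. The computational model is the standard one (quantum circuits over exactly implementable elementary gates acting on a bounded number of qubits, together with measurements in the computational basis and classical polynomial-time processing). A $\mathcal{QP}$-algorithm is an algorithm for a quantum computer that runs in guaranteed worst-case polynomial time and whose answer is correct with certainty (exact quantum polynomial time). "Polynomial" is asymptotic in $n$, the algorithm being uniform in $n$, in $\rho$ and in $H_0$. *)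

theory Defs
  imports
    "HOL-Algebra.Generated_Groups"
    "HOL-Probability.Probability_Mass_Function"
    "HOL-Computational_Algebra.Polynomial"
    "Jordan_Normal_Form.Schur_Decomposition"
begin

section \<open>Simon's promise\<close>

text \<open>On lists of equal length, \<open>map2 (\<noteq>)\<close> is the bitwise exclusive-or.\<close>

definition Z2 :: "nat \<Rightarrow> bool list monoid" where
  "Z2 n = \<lparr>carrier = {x. length x = n}, monoid.mult = map2 (\<noteq>), one = replicate n False\<rparr>"

definition simon_promise :: "nat \<Rightarrow> bool list set \<Rightarrow> (bool list \<Rightarrow> 'r) \<Rightarrow> bool" where
  "simon_promise n H \<rho> \<longleftrightarrow>
     subgroup H (Z2 n) \<and>
     (\<forall>K \<in> rcosets\<^bsub>Z2 n\<^esub> H. \<forall>x \<in> K. \<forall>y \<in> K. \<rho> x = \<rho> y) \<and>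
     (\<forall>K \<in> rcosets\<^bsub>Z2 n\<^esub> H. \<forall>L \<in> rcosets\<^bsub>Z2 n\<^esub> H.
        K \<noteq> L \<longrightarrow> (\<forall>x \<in> K. \<forall>y \<in> L. \<rho> x \<noteq> \<rho> y))"

section \<open>Quantum states and gates\<close>

text \<open>
  Qubits are numbered by the natural numbers. A computational basis state is the finite set of
  the qubits whose value is 1, and a state assigns an amplitude to every basis state. Only
  states with finitely many non-zero amplitudes are reachable from a basis state, so no
  dimension has to be fixed in advance.
\<close>

type_synonym qstate = "nat set \<Rightarrow> complex"

definition ket :: "nat set \<Rightarrow> qstate" where
  "ket s = (\<lambda>t. if t = s then 1 else 0)"

text \<open>The basis state of the bit string \<open>xs\<close> stored in the qubits \<open>a, a + 1, \<dots>\<close>.\<close>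

definition bits_at :: "nat \<Rightarrow> bool list \<Rightarrow> nat set" where
  "bits_at a xs = {a + i | i. i < length xs \<and> xs ! i}"

text \<open>
  The rows and columns of a gate on \<open>k\<close> qubits are indexed by \<open>0, \<dots>, 2^k - 1\<close>; the first qubit
  of the list \<open>ws\<close> is the least significant bit of the index.
\<close>

definition wire_index :: "nat list \<Rightarrow> nat set \<Rightarrow> nat" where
  "wire_index ws s = horner_sum of_bool 2 (map (\<lambda>w. w \<in> s) ws)"

definition apply_gate :: "complex mat \<Rightarrow> nat list \<Rightarrow> qstate \<Rightarrow> qstate" where
  "apply_gate U ws \<psi> =
     (\<lambda>s. \<Sum>v \<in> Pow (set ws). U $$ (wire_index ws s, wire_index ws v) * \<psi> ((s - set ws) \<union> v))"

definition qgate :: "nat \<Rightarrow> complex mat \<Rightarrow> bool" where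
  "qgate k U \<longleftrightarrow> U \<in> carrier_mat (2 ^ k) (2 ^ k) \<and> mat_adjoint U * U = 1\<^sub>m (2 ^ k)"

definition elementary_gates :: "complex mat set \<Rightarrow> bool" where
  "elementary_gates \<G> \<longleftrightarrow> (\<exists>b. \<forall>U \<in> \<G>. \<exists>k \<le> b. qgate k U)"

section \<open>Measurement-free circuits\<close>

type_synonym circuit = "(complex mat \<times> nat list) list"

definition circuit_over :: "complex mat set \<Rightarrow> nat \<Rightarrow> circuit \<Rightarrow> bool" where
  "circuit_over \<G> w C \<longleftrightarrow>
     (\<forall>(U, ws) \<in> set C. U \<in> \<G> \<and> qgate (length ws) U \<and> distinct ws \<and> set ws \<subseteq> {..<w})"

definition run_circuit :: "circuit \<Rightarrow> qstate \<Rightarrow> qstate" where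
  "run_circuit C = fold (\<lambda>(U, ws). apply_gate U ws) C"

text \<open>
  The circuit has \<open>w\<close> qubits: \<open>x\<close> is stored in the first \<open>n\<close>, \<open>y\<close> in the next \<open>m\<close>, and the
  remaining ones are work qubits, which start as 0 and must be returned as 0.
\<close>

definition computes ::
  "complex mat set \<Rightarrow> nat \<Rightarrow> circuit \<Rightarrow> nat \<Rightarrow> nat \<Rightarrow> (bool list \<Rightarrow> bool list) \<Rightarrow> bool" where
  "computes \<G> w C n m f \<longleftrightarrow>
     n + m \<le> w \<and> circuit_over \<G> w C \<and>
     (\<forall>x \<in> carrier (Z2 n). \<forall>y \<in> carrier (Z2 m).
        run_circuit C (ket (bits_at 0 x \<union> bits_at n y)) =
        ket (bits_at 0 x \<union> bits_at n (y \<otimes>\<^bsub>Z2 m\<^esub> f x)))"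

definition circuit_size :: "nat \<Rightarrow> circuit \<Rightarrow> nat" where
  "circuit_size w C = w + length C"

section \<open>Quantum programs with classical control\<close>

datatype elem_gate = Hadamard | PauliX | PhaseS | PhaseT | CNot | Toffoli

text \<open>In \<open>CNot\<close> and \<open>Toffoli\<close> the target is the last qubit.\<close>

fun arity :: "elem_gate \<Rightarrow> nat" where
  "arity CNot = 2"
| "arity Toffoli = 3"
| "arity _ = 1"

fun gate_mat :: "elem_gate \<Rightarrow> complex mat" where
  "gate_mat Hadamard =
     mat_of_rows_list 2 [[1 / sqrt 2, 1 / sqrt 2], [1 / sqrt 2, - (1 / sqrt 2)]]"
| "gate_mat PauliX = mat_of_rows_list 2 [[0, 1], [1, 0]]"
| "gate_mat PhaseS = mat_of_rows_list 2 [[1, 0], [0, \<i>]]"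
| "gate_mat PhaseT = mat_of_rows_list 2 [[1, 0], [0, cis (pi / 4)]]"
| "gate_mat CNot = mat_of_rows_list 4 [[1, 0, 0, 0], [0, 0, 0, 1], [0, 0, 1, 0], [0, 1, 0, 0]]"
| "gate_mat Toffoli =
     mat 8 8 (\<lambda>(i, j). if j = (if i = 3 then 7 else if i = 7 then 3 else i) then 1 else 0)"

text \<open>
  The classical part is a successor random access machine with structured control: a step
  increases the largest stored number by at most 1, up to constants of the program, so unit
  cost is polynomially related to the running time of Turing machines. Registers are numbered
  by the natural numbers; \<open>Load r a\<close> reads and \<open>Store a r\<close> writes the register whose number
  is the content of \<open>a\<close>. The qubits of \<open>Apply\<close> and the measured qubit, which is the first
  argument of \<open>Measure\<close>, are likewise addressed by register contents. \<open>Subroutine\<close> applies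
  the given circuit, wire \<open>i\<close> being qubit \<open>i\<close>; programs cannot access it in any other way.
\<close>

datatype instr =
    Const nat nat
  | Move nat nat
  | Inc nat
  | Dec nat
  | Load nat nat
  | Store nat nat
  | Branch nat "instr list" "instr list"
  | Loop nat "instr list"
  | Apply elem_gate "nat list"
  | Measure nat nat
  | Subroutine

record config =
  prog :: "instr list"
  mem :: "nat \<Rightarrow> nat"
  qst :: qstate
  clock :: nat

definition outcome_prob :: "nat \<Rightarrow> bool \<Rightarrow> qstate \<Rightarrow> real" where
  "outcome_prob q b \<psi> = (\<Sum>s | (q \<in> s) = b \<and> \<psi> s \<noteq> 0. (cmod (\<psi> s))\<^sup>2)"

definition collapse :: "nat \<Rightarrow> bool \<Rightarrow> qstate \<Rightarrow> qstate" where
  "collapse q b \<psi> = (\<lambda>s. if (q \<in> s) = b then \<psi> s / sqrt (outcome_prob q b \<psi>) else 0)"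

text \<open>
  A gate applied to the wrong number of qubits or to coinciding qubits leaves the machine
  stuck: the configuration is repeated for ever and never becomes final.
\<close>

fun exec_instr :: "nat \<Rightarrow> circuit \<Rightarrow> instr \<Rightarrow> config \<Rightarrow> config pmf" where
  "exec_instr w C (Const r k) c =
     return_pmf (c\<lparr>mem := (mem c)(r := k), clock := clock c + 1\<rparr>)"
| "exec_instr w C (Move r a) c =
     return_pmf (c\<lparr>mem := (mem c)(r := mem c a), clock := clock c + 1\<rparr>)"
| "exec_instr w C (Inc r) c =
     return_pmf (c\<lparr>mem := (mem c)(r := mem c r + 1), clock := clock c + 1\<rparr>)"
| "exec_instr w C (Dec r) c =
     return_pmf (c\<lparr>mem := (mem c)(r := mem c r - 1), clock := clock c + 1\<rparr>)"
| "exec_instr w C (Load r a) c =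
     return_pmf (c\<lparr>mem := (mem c)(r := mem c (mem c a)), clock := clock c + 1\<rparr>)"
| "exec_instr w C (Store a r) c =
     return_pmf (c\<lparr>mem := (mem c)(mem c a := mem c r), clock := clock c + 1\<rparr>)"
| "exec_instr w C (Branch r P Q) c =
     return_pmf (c\<lparr>prog := (if mem c r \<noteq> 0 then P else Q) @ prog c, clock := clock c + 1\<rparr>)"
| "exec_instr w C (Loop r P) c =
     return_pmf (c\<lparr>prog := (if mem c r \<noteq> 0 then P @ [Loop r P] else []) @ prog c,
                   clock := clock c + 1\<rparr>)"
| "exec_instr w C (Apply g rs) c =
     (let ws = map (mem c) rs in
      if length ws = arity g \<and> distinct ws
      then return_pmf (c\<lparr>qst := apply_gate (gate_mat g) ws (qst c), clock := clock c + 1\<rparr>)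
      else return_pmf (c\<lparr>prog := Apply g rs # prog c\<rparr>))"
| "exec_instr w C (Measure a r) c =
     map_pmf (\<lambda>b. c\<lparr>mem := (mem c)(r := of_bool b), qst := collapse (mem c a) b (qst c),
                    clock := clock c + 1\<rparr>)
       (bernoulli_pmf (outcome_prob (mem c a) True (qst c)))"
| "exec_instr w C Subroutine c =
     return_pmf (c\<lparr>qst := run_circuit C (qst c), clock := clock c + circuit_size w C + 1\<rparr>)"

definition step :: "nat \<Rightarrow> circuit \<Rightarrow> config \<Rightarrow> config pmf" where
  "step w C c = (case prog c of [] \<Rightarrow> return_pmf c | i # P \<Rightarrow> exec_instr w C i (c\<lparr>prog := P\<rparr>))"

fun run :: "nat \<Rightarrow> circuit \<Rightarrow> nat \<Rightarrow> config \<Rightarrow> config pmf" where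
  "run w C 0 c = return_pmf c"
| "run w C (Suc t) c = bind_pmf (step w C c) (run w C t)"

text \<open>
  The program receives \<open>n\<close> and the layout of the subroutine: the number \<open>m\<close> of result bits and
  the number \<open>w\<close> of qubits.
\<close>

definition init :: "instr list \<Rightarrow> nat \<Rightarrow> nat \<Rightarrow> nat \<Rightarrow> config" where
  "init A n m w = \<lparr>prog = A, mem = (\<lambda>_. 0)(0 := n, 1 := m, 2 := w), qst = ket {}, clock = 0\<rparr>"

text \<open>
  Register 0 holds the number of vectors in the output and register 1 the number of the
  register at which the concatenation of these vectors starts.
\<close>

definition output_set :: "nat \<Rightarrow> (nat \<Rightarrow> nat) \<Rightarrow> bool list set" where
  "output_set n \<sigma> = {map (\<lambda>j. \<sigma> (\<sigma> 1 + i * n + j) \<noteq> 0) [0..<n] | i. i < \<sigma> 0}"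

text \<open>
  Every instruction takes time at least 1, so a computation of running time at most \<open>T\<close> is
  final after \<open>T\<close> steps. The time bound concerns every computation of positive probability.
\<close>

definition exact_in_time ::
  "instr list \<Rightarrow> nat \<Rightarrow> circuit \<Rightarrow> nat \<Rightarrow> nat \<Rightarrow> nat \<Rightarrow> (bool list set \<Rightarrow> bool) \<Rightarrow> bool" where
  "exact_in_time A w C n m T correct \<longleftrightarrow>
     (\<forall>c \<in> set_pmf (run w C T (init A n m w)). prog c = [] \<and> clock c \<le> T) \<and>
     measure_pmf.prob (run w C T (init A n m w)) {c. \<not> correct (output_set n (mem c))} = 0"

end

(*
  Simon's algorithm without amplitude amplification. The memory holds an n x n bit matrix B whose
  rows b_i span a space containing H; in round j the rows before b_j are already in H. Let
  f z = rho (z B) on uniformly distributed z, and let the control qubit c be in the state |->.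
  Writing f z to an empty register r, adding c to z_j and adding f z to r again leaves
  f z + f (z + c e_j) in r. If b_j is not in H, this is 0 iff c = 0, so adding [r = 0] to c erases
  c; a third evaluation makes r = f z for the new z. Then the state is invariant under
  translations of z by every h with h B in H, since c and r depend on the coset only, and changes
  its sign under translation by e_j. After Hadamard gates, a measured y therefore has y.h = 0 for
  these h with certainty, and y_j = 1 if b_j is not in H. Adding y_i b_j to b_i for every i keeps
  H in the span of the rows and moves b_j into H: if y_j = 1 the row becomes 0, otherwise it was in H
  before. After n rounds the rows generate H.

  All facts about measurements concern only the support of the state, which is obtained from
  the Pauli operators stabilizing it.
*)
theory Submission
  imports Defs
begin

section \<open>A calculus for programs\<close>

text \<open>An ordinary Simon round may return y = 0, so it bounds only the expected number of
  rounds; here round j must give y_j = 1 whenever b_j is not in H. In that case r ends with f z for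
  the z before the shift: up to normalization the state is the sum over z of |f z>(|z> - |z +
  e_j>)|c = 1>, and its antisymmetry under e_j is what the last Hadamard layer turns into y_j = 1.
  Erasing c is essential, because a surviving c would record which of the two terms was taken and
  prevent them from interfering. The detour through z B makes the direction under test always a unit
  vector e_j, so that the shift is a single controlled NOT and b_j enters only through the matrix.
  If b_j is in H, the same circuit gives y_j = 0 and row j stays, so the program need not know which
  case holds. Only Hadamard, NOT, CNOT and Toffoli gates occur; no rotation depends on the unknown
  dimension of H, and therefore nothing has to be approximated.\<close>

locale machine =
  fixes w :: nat and C :: circuit
begin

text \<open>Total correctness over every outcome of positive probability. The strict increase of the
  clock in \<open>later\<close> makes \<open>D\<close> bound the number of steps too, and it
  excludes stuck configurations, which repeat themselves with an unchanged clock.\<close>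

inductive reaches :: "nat \<Rightarrow> (config \<Rightarrow> bool) \<Rightarrow> config \<Rightarrow> bool" for D \<Phi> where
  now: "\<Phi> c \<Longrightarrow> clock c \<le> D \<Longrightarrow> reaches D \<Phi> c"
| later: "(\<And>c'. c' \<in> set_pmf (step w C c) \<Longrightarrow> clock c < clock c' \<and> reaches D \<Phi> c') \<Longrightarrow> reaches D \<Phi> c"

lemma reaches_clock_le: "reaches D \<Phi> c \<Longrightarrow> clock c \<le> D"
proof (induction rule: reaches.induct)
  case (later c)
  obtain c' where "c' \<in> set_pmf (step w C c)"
    using set_pmf_not_empty[of "step w C c"] by blast
  with later show ?case by fastforce
qed

lemma reaches_trans:
  assumes "reaches D \<Phi> c" and "\<And>c. \<Phi> c \<Longrightarrow> clock c \<le> D \<Longrightarrow> reaches D' \<Psi> c"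
  shows "reaches D' \<Psi> c"
  using assms
proof (induction rule: reaches.induct)
  case (later c)
  show ?case by (rule reaches.later) (use later in blast)
qed simp

lemma run_finished: "prog c = [] \<Longrightarrow> run w C t c = return_pmf c"
  by (induction t) (auto simp: step_def bind_return_pmf)

text \<open>Every step before the goal advances the clock, and a goal configuration is final and
  repeats itself. Hence any \<open>t\<close> with \<open>D \<le> clock c + t\<close> is enough, and
  surplus steps do no harm.\<close>

lemma reaches_run:
  assumes "reaches D \<Phi> c" and "\<And>c. \<Phi> c \<Longrightarrow> prog c = []"
    and "c' \<in> set_pmf (run w C t c)" and "D \<le> clock c + t"
  shows "\<Phi> c' \<and> clock c' \<le> D"
  using assms
proof (induction arbitrary: t rule: reaches.induct)
  case (now c)
  then show ?case by (simp add: run_finished)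
next
  case (later c)
  show ?case
  proof (cases t)
    \<comment> \<open>With no step left the clock would already have reached \<open>D\<close>, but a
      successor is strictly later and still at most \<open>D\<close>.\<close>
    case 0
    obtain c1 where "c1 \<in> set_pmf (step w C c)"
      using set_pmf_not_empty[of "step w C c"] by blast
    then have "clock c < clock c1" "clock c1 \<le> D"
      using later.IH reaches_clock_le by blast+
    then show ?thesis using 0 later.prems by simp
  next
    case (Suc u)
    then obtain c1 where c1: "c1 \<in> set_pmf (step w C c)" "c' \<in> set_pmf (run w C u c1)"
      using later.prems by (auto simp: set_bind_pmf)
    have "clock c < clock c1" using later.IH c1 by blast
    then have "D \<le> clock c1 + u" using later.prems Suc by simp
    then show ?thesis using later.IH[OF c1(1)] c1 later.prems(1) by blast
  qed
qed

text \<open>Quantifying over the rest \<open>P\<close> of the program and the start time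
  \<open>k\<close> makes the judgement local: \<open>T\<close> is a relative cost, and blocks
  compose without reference to what follows.\<close>

definition wp ::
  "instr list \<Rightarrow> nat \<Rightarrow> ((nat \<Rightarrow> nat) \<Rightarrow> qstate \<Rightarrow> bool) \<Rightarrow> (nat \<Rightarrow> nat) \<Rightarrow> qstate \<Rightarrow> bool" where
  "wp A T Q \<sigma> \<psi> \<longleftrightarrow>
     (\<forall>P k. reaches (k + T) (\<lambda>c. prog c = P \<and> Q (mem c) (qst c))
        \<lparr>prog = A @ P, mem = \<sigma>, qst = \<psi>, clock = k\<rparr>)"

lemma wp_mono:
  assumes "wp A T Q \<sigma> \<psi>" and "T \<le> T'" and "\<And>\<sigma> \<psi>. Q \<sigma> \<psi> \<Longrightarrow> Q' \<sigma> \<psi>"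
  shows "wp A T' Q' \<sigma> \<psi>"
  unfolding wp_def
proof (intro allI)
  fix P k
  show "reaches (k + T') (\<lambda>c. prog c = P \<and> Q' (mem c) (qst c))
        \<lparr>prog = A @ P, mem = \<sigma>, qst = \<psi>, clock = k\<rparr>"
    by (rule reaches_trans[OF assms(1)[unfolded wp_def, rule_format]])
      (rule reaches.now, use assms in auto)
qed

lemma wp_Nil: "Q \<sigma> \<psi> \<Longrightarrow> wp [] T Q \<sigma> \<psi>"
  unfolding wp_def by (intro allI reaches.now) auto

lemma wp_append:
  assumes "wp A T1 (wp B T2 Q) \<sigma> \<psi>"
  shows "wp (A @ B) (T1 + T2) Q \<sigma> \<psi>"
  unfolding wp_def
proof (intro allI)
  fix P k
  show "reaches (k + (T1 + T2)) (\<lambda>c. prog c = P \<and> Q (mem c) (qst c))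
        \<lparr>prog = (A @ B) @ P, mem = \<sigma>, qst = \<psi>, clock = k\<rparr>"
    unfolding append_assoc
  proof (rule reaches_trans[OF assms[unfolded wp_def[of A], rule_format]])
    fix c :: config assume c: "prog c = B @ P \<and> wp B T2 Q (mem c) (qst c)" "clock c \<le> k + T1"
    have "reaches (clock c + T2) (\<lambda>c. prog c = P \<and> Q (mem c) (qst c))
        \<lparr>prog = B @ P, mem = mem c, qst = qst c, clock = clock c\<rparr>"
      using c(1) unfolding wp_def by blast
    moreover have "\<lparr>prog = B @ P, mem = mem c, qst = qst c, clock = clock c\<rparr> = c"
      using c(1) by (cases c) auto
    ultimately have "reaches (clock c + T2) (\<lambda>c. prog c = P \<and> Q (mem c) (qst c)) c" by simp
    then show "reaches (k + (T1 + T2)) (\<lambda>c. prog c = P \<and> Q (mem c) (qst c)) c"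
      by (rule reaches_trans) (rule reaches.now, use c in auto)
  qed
qed

text \<open>The common source of the rules for single instructions: \<open>d\<close> is the cost and
  \<open>B\<close> the code pushed in front of the rest. The rest is a variable, equated with
  \<open>A @ P'\<close> only at the end, so that the instruction is evaluated on an opaque
  tail.\<close>

lemma wp_step:
  assumes "0 < d" and "d \<le> T"
    and "\<And>P k c'. c' \<in> set_pmf (exec_instr w C i \<lparr>prog = P, mem = \<sigma>, qst = \<psi>, clock = k\<rparr>) \<Longrightarrow>
      \<exists>B \<sigma>' \<psi>'. c' = \<lparr>prog = B @ P, mem = \<sigma>', qst = \<psi>', clock = k + d\<rparr> \<and> (\<forall>P'. P = A @ P' \<longrightarrow> wp (B @ A) (T - d) Q \<sigma>' \<psi>')"
  shows "wp (i # A) T Q \<sigma> \<psi>"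
  unfolding wp_def
proof (intro allI)
  fix P k
  show "reaches (k + T) (\<lambda>c. prog c = P \<and> Q (mem c) (qst c))
        \<lparr>prog = (i # A) @ P, mem = \<sigma>, qst = \<psi>, clock = k\<rparr>"
  proof (rule reaches.later)
    fix c' assume "c' \<in> set_pmf (step w C \<lparr>prog = (i # A) @ P, mem = \<sigma>, qst = \<psi>, clock = k\<rparr>)"
    then have "c' \<in> set_pmf (exec_instr w C i \<lparr>prog = A @ P, mem = \<sigma>, qst = \<psi>, clock = k\<rparr>)"
      by (simp add: step_def)
    from assms(3)[OF this] obtain B \<sigma>' \<psi>'
      where c': "c' = \<lparr>prog = B @ A @ P, mem = \<sigma>', qst = \<psi>', clock = k + d\<rparr>"
        and wp: "wp (B @ A) (T - d) Q \<sigma>' \<psi>'" by blast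
    have "reaches (k + d + (T - d)) (\<lambda>c. prog c = P \<and> Q (mem c) (qst c)) c'"
      unfolding c' using wp[unfolded wp_def] by simp
    then show "clock \<lparr>prog = (i # A) @ P, mem = \<sigma>, qst = \<psi>, clock = k\<rparr> < clock c' \<and>
      reaches (k + T) (\<lambda>c. prog c = P \<and> Q (mem c) (qst c)) c'"
      using assms(1,2) c' by simp
  qed
qed

lemma wp_Const: "0 < T \<Longrightarrow> wp A (T - 1) Q (\<sigma>(r := k)) \<psi> \<Longrightarrow> wp (Const r k # A) T Q \<sigma> \<psi>"
  by (rule wp_step[where d = 1]) (auto intro: exI[of _ "[]"])

lemma wp_Move: "0 < T \<Longrightarrow> wp A (T - 1) Q (\<sigma>(r := \<sigma> a)) \<psi> \<Longrightarrow> wp (Move r a # A) T Q \<sigma> \<psi>"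
  by (rule wp_step[where d = 1]) (auto intro: exI[of _ "[]"])

lemma wp_Inc: "0 < T \<Longrightarrow> wp A (T - 1) Q (\<sigma>(r := \<sigma> r + 1)) \<psi> \<Longrightarrow> wp (Inc r # A) T Q \<sigma> \<psi>"
  by (rule wp_step[where d = 1]) (auto intro: exI[of _ "[]"])

lemma wp_Dec: "0 < T \<Longrightarrow> wp A (T - 1) Q (\<sigma>(r := \<sigma> r - 1)) \<psi> \<Longrightarrow> wp (Dec r # A) T Q \<sigma> \<psi>"
  by (rule wp_step[where d = 1]) (auto intro: exI[of _ "[]"])

lemma wp_Load: "0 < T \<Longrightarrow> wp A (T - 1) Q (\<sigma>(r := \<sigma> (\<sigma> a))) \<psi> \<Longrightarrow> wp (Load r a # A) T Q \<sigma> \<psi>"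
  by (rule wp_step[where d = 1]) (auto intro: exI[of _ "[]"])

lemma wp_Store: "0 < T \<Longrightarrow> wp A (T - 1) Q (\<sigma>(\<sigma> a := \<sigma> r)) \<psi> \<Longrightarrow> wp (Store a r # A) T Q \<sigma> \<psi>"
  by (rule wp_step[where d = 1]) (auto intro: exI[of _ "[]"])

lemma wp_Branch:
  assumes "0 < T" and "\<sigma> r \<noteq> 0 \<Longrightarrow> wp (P @ A) (T - 1) Q \<sigma> \<psi>"
    and "\<sigma> r = 0 \<Longrightarrow> wp (P' @ A) (T - 1) Q \<sigma> \<psi>"
  shows "wp (Branch r P P' # A) T Q \<sigma> \<psi>"
  by (rule wp_step[where d = 1]) (use assms in auto)

lemma wp_Apply:
  assumes "0 < T" and "length rs = arity g" and "distinct (map \<sigma> rs)"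
    and "wp A (T - 1) Q \<sigma> (apply_gate (gate_mat g) (map \<sigma> rs) \<psi>)"
  shows "wp (Apply g rs # A) T Q \<sigma> \<psi>"
  by (rule wp_step[where d = 1]) (use assms in \<open>auto simp: Let_def intro: exI[of _ "[]"]\<close>)

lemma wp_Measure:
  assumes "0 < T"
    and "\<And>b. b \<in> set_pmf (bernoulli_pmf (outcome_prob (\<sigma> a) True \<psi>)) \<Longrightarrow>
      wp A (T - 1) Q (\<sigma>(r := of_bool b)) (collapse (\<sigma> a) b \<psi>)"
  shows "wp (Measure a r # A) T Q \<sigma> \<psi>"
  by (rule wp_step[where d = 1]) (use assms in \<open>auto simp del: set_pmf_bernoulli intro: exI[of _ "[]"]\<close>)

lemma wp_Subroutine:
  assumes "circuit_size w C < T" and "wp A (T - (circuit_size w C + 1)) Q \<sigma> (run_circuit C \<psi>)"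
  shows "wp (Subroutine # A) T Q \<sigma> \<psi>"
  by (rule wp_step[where d = "circuit_size w C + 1"]) (use assms in \<open>auto intro: exI[of _ "[]"]\<close>)

text \<open>The invariant is indexed by the counter, which the body lowers by one. Each iteration
  costs the body and one test, and the failing test accounts for the extra 1.\<close>

lemma wp_Loop:
  assumes "\<And>k \<sigma> \<psi>. I (Suc k) \<sigma> \<psi> \<Longrightarrow> \<sigma> r = Suc k \<Longrightarrow> wp P B (\<lambda>\<sigma> \<psi>. \<sigma> r = k \<and> I k \<sigma> \<psi>) \<sigma> \<psi>"
    and "\<And>\<sigma> \<psi>. I 0 \<sigma> \<psi> \<Longrightarrow> \<sigma> r = 0 \<Longrightarrow> wp A T Q \<sigma> \<psi>"
    and "I (\<sigma> r) \<sigma> \<psi>"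
  shows "wp (Loop r P # A) (\<sigma> r * (B + 1) + 1 + T) Q \<sigma> \<psi>"
  using assms(3)
proof (induction "\<sigma> r" arbitrary: \<sigma> \<psi>)
  case 0
  then have wp: "wp A T Q \<sigma> \<psi>" by (metis assms(2))
  have r: "\<sigma> r = 0" using 0 by simp
  show ?case
  proof (rule wp_step[where d = 1])
    fix P' k c'
    assume "c' \<in> set_pmf (exec_instr w C (Loop r P) \<lparr>prog = P', mem = \<sigma>, qst = \<psi>, clock = k\<rparr>)"
    then have "c' = \<lparr>prog = [] @ P', mem = \<sigma>, qst = \<psi>, clock = k + 1\<rparr>" by (simp add: r)
    moreover have "wp ([] @ A) (\<sigma> r * (B + 1) + 1 + T - 1) Q \<sigma> \<psi>" using wp by (simp add: r)
    ultimately show "\<exists>B' \<sigma>' \<psi>'. c' = \<lparr>prog = B' @ P', mem = \<sigma>', qst = \<psi>', clock = k + 1\<rparr> \<and>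
      (\<forall>P''. P' = A @ P'' \<longrightarrow> wp (B' @ A) (\<sigma> r * (B + 1) + 1 + T - 1) Q \<sigma>' \<psi>')"
      by blast
  qed auto
next
  case (Suc k)
  have r: "\<sigma> r = Suc k" using Suc.hyps(2) by (rule sym)
  have "wp P B (\<lambda>\<sigma> \<psi>. \<sigma> r = k \<and> I k \<sigma> \<psi>) \<sigma> \<psi>"
    by (rule assms(1)) (use Suc.prems r in simp_all)
  then have "wp P B (wp (Loop r P # A) (k * (B + 1) + 1 + T) Q) \<sigma> \<psi>"
  proof (rule wp_mono)
    fix \<sigma>' \<psi>' assume "\<sigma>' r = k \<and> I k \<sigma>' \<psi>'"
    then show "wp (Loop r P # A) (k * (B + 1) + 1 + T) Q \<sigma>' \<psi>'"
      using Suc.hyps(1)[of \<sigma>' \<psi>'] by simp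
  qed simp
  then have "wp (P @ Loop r P # A) (B + (k * (B + 1) + 1 + T)) Q \<sigma> \<psi>"
    by (rule wp_append)
  moreover have "\<sigma> r * (B + 1) + 1 + T - 1 = B + (k * (B + 1) + 1 + T)"
    using r by simp
  ultimately have *: "wp ((P @ [Loop r P]) @ A) (\<sigma> r * (B + 1) + 1 + T - 1) Q \<sigma> \<psi>"
    by (simp only: append_assoc append.simps)
  show ?case
  proof (rule wp_step[where d = 1])
    fix P' k' c'
    assume "c' \<in> set_pmf (exec_instr w C (Loop r P) \<lparr>prog = P', mem = \<sigma>, qst = \<psi>, clock = k'\<rparr>)"
    then have "c' = \<lparr>prog = (P @ [Loop r P]) @ P', mem = \<sigma>, qst = \<psi>, clock = k' + 1\<rparr>"
      using r by simp
    with * show "\<exists>B' \<sigma>' \<psi>'. c' = \<lparr>prog = B' @ P', mem = \<sigma>', qst = \<psi>', clock = k' + 1\<rparr> \<and>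
      (\<forall>P''. P' = A @ P'' \<longrightarrow> wp (B' @ A) (\<sigma> r * (B + 1) + 1 + T - 1) Q \<sigma>' \<psi>')"
      by blast
  qed auto
qed

end

section \<open>The gates as operations on states\<close>

text \<open>Symmetric difference, that is, addition over the two-element field for vectors given by
  their supports; on basis states it is a product of Pauli X operators.\<close>

definition tog :: "'a set \<Rightarrow> 'a set \<Rightarrow> 'a set" where
  "tog h s = {x. (x \<in> s) \<noteq> (x \<in> h)}"

lemma mem_tog [simp]: "x \<in> tog h s \<longleftrightarrow> (x \<in> s) \<noteq> (x \<in> h)"
  by (simp add: tog_def)

lemma tog_empty [simp]: "tog {} s = s"
  by (auto simp: set_eq_iff)

lemma tog_tog_same [simp]: "tog h (tog h s) = s"
  by (auto simp: set_eq_iff)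

lemma tog_commute: "tog h (tog k s) = tog k (tog h s)"
  by (auto simp: set_eq_iff)

lemma wire_index_1: "wire_index [a] s = of_bool (a \<in> s)"
  by (simp add: wire_index_def)

lemma wire_index_2: "wire_index [a, b] s = of_bool (a \<in> s) + 2 * of_bool (b \<in> s)"
  by (simp add: wire_index_def)

lemma wire_index_3:
  "wire_index [a, b, c] s = of_bool (a \<in> s) + 2 * of_bool (b \<in> s) + 4 * of_bool (c \<in> s)"
  by (simp add: wire_index_def)

lemma sum_Pow_insert:
  assumes "finite A" "a \<notin> A"
  shows "sum f (Pow (insert a A)) = sum f (Pow A) + sum (\<lambda>v. f (insert a v)) (Pow A)"
proof -
  have inj: "inj_on (insert a) (Pow A)"
    using assms(2) by (intro inj_onI) (metis Diff_insert_absorb PowD subsetD)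
  have "Pow A \<inter> insert a ` Pow A = {}" using assms(2) by auto
  then have "sum f (Pow (insert a A)) = sum f (Pow A) + sum f (insert a ` Pow A)"
    using assms(1) by (simp add: Pow_insert sum.union_disjoint)
  then show ?thesis by (simp add: sum.reindex[OF inj])
qed

definition hadamard :: "nat \<Rightarrow> qstate \<Rightarrow> qstate" where
  "hadamard q \<psi> = (\<lambda>s. (\<psi> (s - {q}) + (if q \<in> s then - 1 else 1) * \<psi> (insert q s)) / sqrt 2)"

lemma apply_Hadamard: "apply_gate (gate_mat Hadamard) [q] \<psi> = hadamard q \<psi>"
proof
  fix s
  have "gate_mat Hadamard $$ (i, j) = (if i = 1 \<and> j = 1 then - 1 else 1) / sqrt 2"
    if "i < 2" "j < 2" for i j
    using that by (auto simp: mat_of_rows_list_def less_2_cases_iff)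
  then show "apply_gate (gate_mat Hadamard) [q] \<psi> s = hadamard q \<psi> s"
    by (simp add: apply_gate_def hadamard_def sum_Pow_insert wire_index_1 add_divide_distrib)
qed

text \<open>The gate permutes basis states by an involution, and the new amplitude at
  \<open>s\<close> is the old one at the preimage. Permutation gates thus act by composition on the
  right, and gates are executed in the order in which the composition is read from left to
  right.\<close>

lemma apply_PauliX: "apply_gate (gate_mat PauliX) [q] \<psi> = \<psi> \<circ> tog {q}"
proof
  fix s
  have "(\<psi> \<circ> tog {q}) s = (if q \<in> s then \<psi> (s - {q}) else \<psi> (insert q s))"
    by (auto intro!: arg_cong[of _ _ \<psi>])
  then show "apply_gate (gate_mat PauliX) [q] \<psi> s = (\<psi> \<circ> tog {q}) s"
    by (simp add: apply_gate_def sum_Pow_insert wire_index_1 mat_of_rows_list_def)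
qed

definition cnot :: "nat \<Rightarrow> nat \<Rightarrow> nat set \<Rightarrow> nat set" where
  "cnot a b s = tog (if a \<in> s then {b} else {}) s"

lemma apply_CNot:
  assumes "a \<noteq> b"
  shows "apply_gate (gate_mat CNot) [a, b] \<psi> = \<psi> \<circ> cnot a b"
proof
  fix s
  have "(\<psi> \<circ> cnot a b) s =
      (if a \<in> s then (if b \<in> s then \<psi> (insert a (s - {a, b})) else \<psi> (insert a (insert b (s - {a, b}))))
       else if b \<in> s then \<psi> (insert b (s - {a, b})) else \<psi> (s - {a, b}))"
    using assms by (auto simp: cnot_def intro!: arg_cong[of _ _ \<psi>])
  then show "apply_gate (gate_mat CNot) [a, b] \<psi> s = (\<psi> \<circ> cnot a b) s"
    using assms
    by (simp add: apply_gate_def sum_Pow_insert wire_index_2 mat_of_rows_list_def)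
qed

definition toff :: "nat \<Rightarrow> nat \<Rightarrow> nat \<Rightarrow> nat set \<Rightarrow> nat set" where
  "toff a b c s = tog (if a \<in> s \<and> b \<in> s then {c} else {}) s"

lemma apply_Toffoli:
  assumes "distinct [a, b, c]"
  shows "apply_gate (gate_mat Toffoli) [a, b, c] \<psi> = \<psi> \<circ> toff a b c"
proof
  fix s
  let ?W = "{a, b, c}" and ?v0 = "toff a b c s \<inter> {a, b, c}"
  \<comment> \<open>The row of \<open>s\<close> has a single non-zero entry; the claim is a truth
    table over the three qubits of \<open>s\<close> and of \<open>v\<close>.\<close>
  have entry: "gate_mat Toffoli $$ (wire_index [a, b, c] s, wire_index [a, b, c] v) = (if v = ?v0 then 1 else 0)"
    if "v \<in> Pow ?W" for v
  proof -
    have eq: "v = ?v0 \<longleftrightarrow>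
        (a \<in> v \<longleftrightarrow> a \<in> s) \<and> (b \<in> v \<longleftrightarrow> b \<in> s) \<and> (c \<in> v \<longleftrightarrow> (c \<in> s) \<noteq> (a \<in> s \<and> b \<in> s))"
    proof -
      have "v = ?v0 \<longleftrightarrow> (\<forall>x\<in>?W. x \<in> v \<longleftrightarrow> x \<in> ?v0)" using that by blast
      moreover have "a \<in> ?v0 \<longleftrightarrow> a \<in> s" "b \<in> ?v0 \<longleftrightarrow> b \<in> s" "c \<in> ?v0 \<longleftrightarrow> (c \<in> s) \<noteq> (a \<in> s \<and> b \<in> s)"
        using assms by (auto simp: toff_def)
      ultimately show ?thesis by (simp only: ball_simps simp_thms)
    qed
    show ?thesis
      unfolding eq wire_index_3
      by (cases "a \<in> s"; cases "b \<in> s"; cases "c \<in> s"; cases "a \<in> v"; cases "b \<in> v"; cases "c \<in> v")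
        simp_all
  qed
  have "apply_gate (gate_mat Toffoli) [a, b, c] \<psi> s =
      (\<Sum>v \<in> Pow ?W. if v = ?v0 then \<psi> ((s - ?W) \<union> v) else 0)"
    unfolding apply_gate_def by (rule sum.cong) (simp_all add: entry del: gate_mat.simps)
  also have "\<dots> = \<psi> ((s - ?W) \<union> ?v0)" by simp
  also have "(s - ?W) \<union> ?v0 = toff a b c s" by (auto simp: toff_def)
  finally show "apply_gate (gate_mat Toffoli) [a, b, c] \<psi> s = (\<psi> \<circ> toff a b c) s" by simp
qed

section \<open>Normalized states\<close>

text \<open>\<open>A\<close> makes the norm a finite sum. Normalization matters because
  \<open>bernoulli_pmf\<close> clips its parameter to the unit interval: with norm 1, the possible
  outcomes are exactly those with a non-zero amplitude.\<close>

definition good :: "nat set \<Rightarrow> qstate \<Rightarrow> bool" where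
  "good A \<psi> \<longleftrightarrow> (\<forall>s. \<psi> s \<noteq> 0 \<longrightarrow> s \<subseteq> A) \<and> (\<Sum>s \<in> Pow A. (cmod (\<psi> s))\<^sup>2) = 1"

lemma good_subset: "good A \<psi> \<Longrightarrow> \<psi> s \<noteq> 0 \<Longrightarrow> s \<subseteq> A"
  by (auto simp: good_def)

lemma good_nonzero:
  assumes "good A \<psi>"
  obtains s where "\<psi> s \<noteq> 0"
proof -
  have "\<exists>s. \<psi> s \<noteq> 0"
  proof (rule ccontr)
    assume "\<nexists>s. \<psi> s \<noteq> 0"
    then have "\<psi> = (\<lambda>_. 0)" by auto
    then show False using assms by (simp add: good_def)
  qed
  with that show thesis by blast
qed

lemma good_ket: "finite A \<Longrightarrow> good A (ket {})"
  by (auto simp: good_def ket_def if_distrib[of "\<lambda>x. cmod x ^ 2"] cong: if_cong)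

lemma good_comp:
  assumes "good A \<psi>" and inv: "\<And>s. \<pi> (\<pi> s) = s" and sub: "\<And>s. s \<subseteq> A \<Longrightarrow> \<pi> s \<subseteq> A"
  shows "good A (\<psi> \<circ> \<pi>)"
  unfolding good_def
proof (intro conjI allI impI)
  fix s assume "(\<psi> \<circ> \<pi>) s \<noteq> 0"
  then have "\<pi> s \<subseteq> A" using assms(1) by (auto dest: good_subset)
  then show "s \<subseteq> A" using sub inv by metis
next
  have "(\<Sum>s \<in> Pow A. (cmod ((\<psi> \<circ> \<pi>) s))\<^sup>2) = (\<Sum>s \<in> Pow A. (cmod (\<psi> s))\<^sup>2)"
    by (rule sum.reindex_bij_witness[of _ \<pi> \<pi>]) (use inv sub in auto)
  then show "(\<Sum>s \<in> Pow A. (cmod ((\<psi> \<circ> \<pi>) s))\<^sup>2) = 1"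
    using assms(1) by (simp add: good_def)
qed

lemma good_comp_tog:
  assumes "good A \<psi>" and "\<And>s. D (tog (D s) s) = D s" and "\<And>s. D s \<subseteq> A"
  shows "good A (\<psi> \<circ> (\<lambda>s. tog (D s) s))"
  by (rule good_comp[OF assms(1)]) (use assms(2,3) in \<open>auto simp: subset_iff\<close>)

lemma good_comp_cnot: "good A \<psi> \<Longrightarrow> a \<noteq> b \<Longrightarrow> b \<in> A \<Longrightarrow> good A (\<psi> \<circ> cnot a b)"
  unfolding cnot_def [abs_def] by (rule good_comp_tog) auto

lemma good_comp_tog_const: "good A \<psi> \<Longrightarrow> h \<subseteq> A \<Longrightarrow> good A (\<psi> \<circ> tog h)"
  using good_comp_tog[of A \<psi> "\<lambda>_. h"] by (simp add: comp_def)

lemma parallelogram_complex: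
  fixes x y :: complex
  shows "(cmod ((x + y) / sqrt 2))\<^sup>2 + (cmod ((x - y) / sqrt 2))\<^sup>2 = (cmod x)\<^sup>2 + (cmod y)\<^sup>2"
proof -
  have "(cmod (x + y))\<^sup>2 + (cmod (x - y))\<^sup>2 = 2 * ((cmod x)\<^sup>2 + (cmod y)\<^sup>2)"
    by (simp add: cmod_power2) (simp add: power2_eq_square algebra_simps)
  then show ?thesis
    by (simp add: norm_divide power_divide add_divide_distrib[symmetric])
qed

lemma good_hadamard:
  assumes "finite A" "good A \<psi>" "q \<in> A"
  shows "good A (hadamard q \<psi>)"
  unfolding good_def
proof (intro conjI allI impI)
  fix s assume "hadamard q \<psi> s \<noteq> 0"
  then have "\<psi> (s - {q}) \<noteq> 0 \<or> \<psi> (insert q s) \<noteq> 0" by (auto simp: hadamard_def)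
  then show "s \<subseteq> A" using good_subset[OF assms(2)] assms(3) by blast
next
  define B where "B = A - {q}"
  have A: "A = insert q B" "q \<notin> B" "finite B" using assms by (auto simp: B_def)
  have "(\<Sum>s \<in> Pow A. (cmod (hadamard q \<psi> s))\<^sup>2) =
      (\<Sum>s \<in> Pow B. (cmod (hadamard q \<psi> s))\<^sup>2 + (cmod (hadamard q \<psi> (insert q s)))\<^sup>2)"
    using A by (simp add: sum_Pow_insert sum.distrib)
  also have "\<dots> = (\<Sum>s \<in> Pow B. (cmod (\<psi> s))\<^sup>2 + (cmod (\<psi> (insert q s)))\<^sup>2)"
  proof (rule sum.cong[OF refl])
    fix s assume "s \<in> Pow B"
    then have "q \<notin> s" using A by auto
    then show "(cmod (hadamard q \<psi> s))\<^sup>2 + (cmod (hadamard q \<psi> (insert q s)))\<^sup>2 =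
        (cmod (\<psi> s))\<^sup>2 + (cmod (\<psi> (insert q s)))\<^sup>2"
      using parallelogram_complex[of "\<psi> s" "\<psi> (insert q s)"] by (simp add: hadamard_def)
  qed
  also have "\<dots> = (\<Sum>s \<in> Pow A. (cmod (\<psi> s))\<^sup>2)"
    using A by (simp add: sum_Pow_insert sum.distrib)
  finally show "(\<Sum>s \<in> Pow A. (cmod (hadamard q \<psi> s))\<^sup>2) = 1"
    using assms(2) by (simp add: good_def)
qed

lemma outcome_prob_good:
  assumes "finite A" "good A \<psi>"
  shows "outcome_prob q b \<psi> = (\<Sum>s | s \<in> Pow A \<and> (q \<in> s) = b. (cmod (\<psi> s))\<^sup>2)"
  unfolding outcome_prob_def
  by (rule sum.mono_neutral_left) (use assms in \<open>auto dest: good_subset\<close>)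

lemma outcome_prob_True_False:
  assumes "finite A" "good A \<psi>"
  shows "outcome_prob q True \<psi> + outcome_prob q False \<psi> = 1"
proof -
  have "(\<Sum>s \<in> Pow A. (cmod (\<psi> s))\<^sup>2) =
      (\<Sum>s | s \<in> Pow A \<and> (q \<in> s) = True. (cmod (\<psi> s))\<^sup>2) +
      (\<Sum>s | s \<in> Pow A \<and> (q \<in> s) = False. (cmod (\<psi> s))\<^sup>2)"
    using assms(1) by (subst sum.union_disjoint[symmetric]) (auto intro: sum.cong)
  then show ?thesis using assms by (simp add: outcome_prob_good good_def)
qed

lemma outcome_prob_nonneg: "0 \<le> outcome_prob q b \<psi>"
  by (simp add: outcome_prob_def sum_nonneg)

text \<open>Norm 1 makes the two outcome probabilities add up to 1, so a possible outcome has
  positive probability; the renormalization then divides by a non-zero number and the support is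
  only filtered.\<close>

lemma good_collapse:
  assumes "finite A" "good A \<psi>" "b \<in> set_pmf (bernoulli_pmf (outcome_prob q True \<psi>))"
  shows "good A (collapse q b \<psi>)"
    and "collapse q b \<psi> s \<noteq> 0 \<longleftrightarrow> \<psi> s \<noteq> 0 \<and> (q \<in> s) = b"
proof -
  let ?p = "outcome_prob q b \<psi>"
  have 1: "outcome_prob q True \<psi> + outcome_prob q False \<psi> = 1"
    by (rule outcome_prob_True_False) fact+
  have "pmf (bernoulli_pmf (outcome_prob q True \<psi>)) b \<noteq> 0"
    using assms(3) by (simp add: set_pmf_iff)
  moreover have "pmf (bernoulli_pmf (outcome_prob q True \<psi>)) b = ?p"
    using 1 outcome_prob_nonneg[of q True \<psi>] outcome_prob_nonneg[of q False \<psi>] by (cases b) simp_all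
  ultimately have p: "?p > 0" using outcome_prob_nonneg[of q b \<psi>] by simp
  show nz: "collapse q b \<psi> s \<noteq> 0 \<longleftrightarrow> \<psi> s \<noteq> 0 \<and> (q \<in> s) = b" for s
    using p by (auto simp: collapse_def)
  have "(\<Sum>s \<in> Pow A. (cmod (collapse q b \<psi> s))\<^sup>2) =
      (\<Sum>s | s \<in> Pow A \<and> (q \<in> s) = b. (cmod (collapse q b \<psi> s))\<^sup>2)"
    by (rule sum.mono_neutral_right) (use assms(1) in \<open>auto simp: collapse_def\<close>)
  also have "\<dots> = (\<Sum>s | s \<in> Pow A \<and> (q \<in> s) = b. (cmod (\<psi> s))\<^sup>2 / ?p)"
    using p by (intro sum.cong) (auto simp: collapse_def norm_divide power_divide)
  also have "\<dots> = ?p / ?p"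
    unfolding sum_divide_distrib[symmetric] outcome_prob_good[OF assms(1,2)] ..
  finally have "(\<Sum>s \<in> Pow A. (cmod (collapse q b \<psi> s))\<^sup>2) = 1" using p by simp
  moreover have "s \<subseteq> A" if "collapse q b \<psi> s \<noteq> 0" for s
    using that nz assms(2) good_subset by blast
  ultimately show "good A (collapse q b \<psi>)" by (simp add: good_def)
qed

section \<open>Symmetries of states\<close>

text \<open>\<open>stab h k \<epsilon> \<psi>\<close>: the state is an eigenvector, with eigenvalue \<open>\<epsilon>\<close>, of the Pauli operator that
  flips the qubits in \<open>h\<close> and changes the sign once for every 1 among the qubits in \<open>k\<close>.\<close>

definition parity_sign :: "nat set \<Rightarrow> nat set \<Rightarrow> complex" where
  "parity_sign k s = (if odd (card (s \<inter> k)) then - 1 else 1)"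

definition stab :: "nat set \<Rightarrow> nat set \<Rightarrow> complex \<Rightarrow> qstate \<Rightarrow> bool" where
  "stab h k \<epsilon> \<psi> \<longleftrightarrow> (\<forall>s. parity_sign k s * \<psi> (tog h s) = \<epsilon> * \<psi> s)"

lemma parity_sign_insert:
  assumes "finite k" "q \<notin> s"
  shows "parity_sign k (insert q s) = (if q \<in> k then - 1 else 1) * parity_sign k s"
proof -
  have "insert q s \<inter> k = (if q \<in> k then insert q (s \<inter> k) else s \<inter> k)" by auto
  then show ?thesis using assms by (simp add: parity_sign_def)
qed

lemma parity_sign_remove:
  assumes "finite k" "q \<in> k"
  shows "parity_sign k s = (if q \<in> s then - 1 else 1) * parity_sign (k - {q}) s"
proof -
  have "s \<inter> k = (if q \<in> s then insert q (s \<inter> (k - {q})) else s \<inter> (k - {q}))"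
    using assms(2) by auto
  then show ?thesis using assms by (auto simp: parity_sign_def)
qed

text \<open>Conjugation by a Hadamard gate exchanges Pauli X and Z on \<open>q\<close>, so
  \<open>q\<close> moves from \<open>h\<close> to \<open>k\<close> or back. Disjointness of
  \<open>h\<close> and \<open>k\<close> excludes Pauli Y, whose conjugation would change the
  sign.\<close>

lemma stab_hadamard:
  assumes "finite k" "h \<inter> k = {}" "stab h k \<epsilon> \<psi>"
  shows "stab ((h - {q}) \<union> (k \<inter> {q})) ((k - {q}) \<union> (h \<inter> {q})) \<epsilon> (hadamard q \<psi>)"
  unfolding stab_def
proof
  fix s
  \<comment> \<open>The gate mixes only the amplitudes at \<open>s0\<close> and
    \<open>insert q s0\<close>; the eigenvalue equation is used at both.\<close>
  define s0 where "s0 = s - {q}"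
  have s0: "q \<notin> s0" and s: "s = s0 \<or> s = insert q s0" by (auto simp: s0_def)
  have st: "parity_sign k t * \<psi> (tog h t) = \<epsilon> * \<psi> t" for t
    using assms(3) by (simp add: stab_def)
  consider (in_h) "q \<in> h" "q \<notin> k" | (in_k) "q \<in> k" "q \<notin> h" | (out) "q \<notin> h" "q \<notin> k"
    using assms(2) by blast
  then show "parity_sign ((k - {q}) \<union> (h \<inter> {q})) s * hadamard q \<psi> (tog ((h - {q}) \<union> (k \<inter> {q})) s) =
      \<epsilon> * hadamard q \<psi> s"
  proof cases
    case in_h
    have k: "(k - {q}) \<union> (h \<inter> {q}) = insert q k" "(h - {q}) \<union> (k \<inter> {q}) = h - {q}"
      using in_h by auto
    have ps: "parity_sign (insert q k) s = (if q \<in> s then - 1 else 1) * parity_sign k s0"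
      using s s0 assms(1) in_h parity_sign_insert[of k q s0] parity_sign_remove[of "insert q k" q s]
      by auto
    have t: "tog h s0 = insert q (tog (h - {q}) s0)" "tog h (insert q s0) = tog (h - {q}) s0"
      using in_h s0 by auto
    have q: "q \<notin> tog (h - {q}) s0" using s0 by simp
    have e: "parity_sign k s0 * \<psi> (insert q (tog (h - {q}) s0)) = \<epsilon> * \<psi> s0"
        "parity_sign k s0 * \<psi> (tog (h - {q}) s0) = \<epsilon> * \<psi> (insert q s0)"
      using st[of s0] st[of "insert q s0"] t parity_sign_insert[OF assms(1) s0] in_h by auto
    have hd: "tog (h - {q}) (insert q s0) = insert q (tog (h - {q}) s0)" by auto
    show ?thesis
      using s
    proof
      assume "s = s0"
      then show ?thesis unfolding k using ps s0 q e[symmetric]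
        by (simp add: hadamard_def algebra_simps add_divide_distrib)
    next
      assume "s = insert q s0"
      then show ?thesis unfolding k using ps s0 q e[symmetric] hd
        by (simp add: hadamard_def algebra_simps diff_divide_distrib)
    qed
  next
    case in_k
    have k: "(k - {q}) \<union> (h \<inter> {q}) = k - {q}" "(h - {q}) \<union> (k \<inter> {q}) = insert q h"
      using in_k by auto
    have ps: "parity_sign (k - {q}) s = parity_sign (k - {q}) s0"
      "parity_sign k s0 = parity_sign (k - {q}) s0" "parity_sign k (insert q s0) = - parity_sign (k - {q}) s0"
      using s s0 assms(1) in_k parity_sign_insert[of "k - {q}" q s0] parity_sign_remove[of k q s0]
        parity_sign_insert[of k q s0]
      by auto
    have t: "tog h (insert q s0) = insert q (tog h s0)" using in_k s0 by auto
    have q: "q \<notin> tog h s0" using s0 in_k by simp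
    have e: "parity_sign (k - {q}) s0 * \<psi> (tog h s0) = \<epsilon> * \<psi> s0"
        "- (parity_sign (k - {q}) s0 * \<psi> (insert q (tog h s0))) = \<epsilon> * \<psi> (insert q s0)"
      using st[of s0] st[of "insert q s0"] t ps by auto
    have hd: "tog (insert q h) s0 = insert q (tog h s0)" "tog (insert q h) (insert q s0) = tog h s0"
      using s0 in_k by auto
    show ?thesis
      using s
    proof
      assume "s = s0"
      then show ?thesis unfolding k using ps s0 q e[symmetric] hd
        by (simp add: hadamard_def algebra_simps diff_divide_distrib)
    next
      assume "s = insert q s0"
      then show ?thesis unfolding k using ps s0 q e[symmetric] hd
        by (simp add: hadamard_def algebra_simps add_divide_distrib)
    qed
  next
    case out
    have k: "(k - {q}) \<union> (h \<inter> {q}) = k" "(h - {q}) \<union> (k \<inter> {q}) = h"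
      using out by auto
    have ps: "parity_sign k s = parity_sign k s0" "parity_sign k (insert q s0) = parity_sign k s0"
      using s s0 assms(1) out parity_sign_insert[of k q s0] by auto
    have t: "tog h (insert q s0) = insert q (tog h s0)" using out s0 by auto
    have q: "q \<notin> tog h s0" using s0 out by simp
    have e: "parity_sign k s0 * \<psi> (tog h s0) = \<epsilon> * \<psi> s0"
        "parity_sign k s0 * \<psi> (insert q (tog h s0)) = \<epsilon> * \<psi> (insert q s0)"
      using st[of s0] st[of "insert q s0"] t ps by auto
    show ?thesis
      using s
    proof
      assume "s = s0"
      then show ?thesis unfolding k using ps s0 q e[symmetric]
        by (simp add: hadamard_def algebra_simps add_divide_distrib)
    next
      assume "s = insert q s0"
      then show ?thesis unfolding k using ps s0 q e[symmetric] t
        by (simp add: hadamard_def algebra_simps diff_divide_distrib)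
    qed
  qed
qed

section \<open>The subroutine as an operation on states\<close>

text \<open>The program owns qubits beyond the \<open>w\<close> wires, whereas
  \<open>computes\<close> speaks of basis states on the wires alone. Fixing the content
  \<open>e\<close> of the outer qubits gives a state on the wires, and gates on the wires commute
  with this.\<close>

definition slice :: "nat \<Rightarrow> nat set \<Rightarrow> qstate \<Rightarrow> qstate" where
  "slice w e \<psi> = (\<lambda>t. if t \<subseteq> {..<w} then \<psi> (t \<union> e) else 0)"

lemma apply_gate_slice:
  assumes "set ws \<subseteq> {..<w}" "e \<inter> {..<w} = {}"
  shows "apply_gate U ws (slice w e \<psi>) = slice w e (apply_gate U ws \<psi>)"
proof
  fix s
  show "apply_gate U ws (slice w e \<psi>) s = slice w e (apply_gate U ws \<psi>) s"
  proof (cases "s \<subseteq> {..<w}")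
    case True
    have "wire_index ws (s \<union> e) = wire_index ws s"
      unfolding wire_index_def using assms by (intro arg_cong[of _ _ "horner_sum of_bool 2"]) auto
    moreover have "(s - set ws) \<union> v \<subseteq> {..<w}" "(s \<union> e - set ws) \<union> v = (s - set ws) \<union> v \<union> e"
      if "v \<subseteq> set ws" for v
      using True assms that by auto
    ultimately show ?thesis using True
      by (auto simp: apply_gate_def slice_def intro!: sum.cong)
  next
    case False
    then have "\<not> (s - set ws) \<union> v \<subseteq> {..<w}" for v using assms by auto
    then have "slice w e \<psi> ((s - set ws) \<union> v) = 0" for v by (simp only: slice_def if_False)
    then have "apply_gate U ws (slice w e \<psi>) s = 0" by (simp add: apply_gate_def)
    then show ?thesis using False by (simp add: slice_def)
  qed
qed

lemma run_circuit_slice: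
  assumes "\<And>U ws. (U, ws) \<in> set C \<Longrightarrow> set ws \<subseteq> {..<w}" "e \<inter> {..<w} = {}"
  shows "run_circuit C (slice w e \<psi>) = slice w e (run_circuit C \<psi>)"
  using assms(1) unfolding run_circuit_def
proof (induction C arbitrary: \<psi>)
  case (Cons g C)
  obtain U ws where g: "g = (U, ws)" by force
  have "apply_gate U ws (slice w e \<psi>) = slice w e (apply_gate U ws \<psi>)"
    by (rule apply_gate_slice) (use Cons.prems g assms(2) in auto)
  moreover have "fold (\<lambda>(U, ws). apply_gate U ws) C (slice w e (apply_gate U ws \<psi>)) =
      slice w e (fold (\<lambda>(U, ws). apply_gate U ws) C (apply_gate U ws \<psi>))"
    by (rule Cons.IH) (use Cons.prems in auto)
  ultimately show ?case by (simp add: g)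
qed simp

lemma apply_gate_sum:
  "apply_gate U ws (\<lambda>s. \<Sum>t\<in>T. a t * \<phi> t s) = (\<lambda>s. \<Sum>t\<in>T. a t * apply_gate U ws (\<phi> t) s)"
proof
  fix s
  show "apply_gate U ws (\<lambda>s. \<Sum>t\<in>T. a t * \<phi> t s) s = (\<Sum>t\<in>T. a t * apply_gate U ws (\<phi> t) s)"
    unfolding apply_gate_def sum_distrib_left
    by (subst sum.swap) (simp add: mult.left_commute)
qed

lemma run_circuit_sum:
  "run_circuit C (\<lambda>s. \<Sum>t\<in>T. a t * \<phi> t s) = (\<lambda>s. \<Sum>t\<in>T. a t * run_circuit C (\<phi> t) s)"
  unfolding run_circuit_def
  by (induction C arbitrary: \<phi>) (auto simp: apply_gate_sum)

definition input :: "nat \<Rightarrow> nat set \<Rightarrow> bool list" where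
  "input n s = map (\<lambda>i. i \<in> s) [0..<n]"

definition query :: "nat \<Rightarrow> nat \<Rightarrow> (bool list \<Rightarrow> bool list) \<Rightarrow> nat set \<Rightarrow> nat set" where
  "query n m f s = tog {n + k | k. k < m \<and> f (input n s) ! k} s"

lemma input_tog: "h \<inter> {..<n} = {} \<Longrightarrow> input n (tog h s) = input n s"
  by (auto simp: input_def)

lemma query_query [simp]: "query n m f (query n m f s) = s"
proof -
  have "{n + k | k. k < m \<and> f (input n s) ! k} \<inter> {..<n} = {}" by auto
  then have "input n (query n m f s) = input n s" by (simp add: query_def input_tog)
  then show ?thesis by (simp add: query_def)
qed

lemma bits_at_mem: "q \<in> bits_at a xs \<longleftrightarrow> a \<le> q \<and> q < a + length xs \<and> xs ! (q - a)"
  by (auto simp: bits_at_def le_iff_add)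

lemma bits_at_decode:
  assumes "t \<subseteq> {..<n + m}"
  shows "bits_at 0 (input n t) \<union> bits_at n (map (\<lambda>k. n + k \<in> t) [0..<m]) = t"
proof (rule Set.set_eqI)
  fix q
  show "q \<in> bits_at 0 (input n t) \<union> bits_at n (map (\<lambda>k. n + k \<in> t) [0..<m]) \<longleftrightarrow> q \<in> t"
  proof (cases "n \<le> q \<and> q < n + m")
    case True
    then obtain k where "q = n + k" "k < m" by (metis le_Suc_ex nat_add_left_cancel_less)
    then show ?thesis by (simp add: bits_at_mem input_def)
  next
    case False
    then show ?thesis using assms by (auto simp: bits_at_mem input_def)
  qed
qed

lemma run_circuit_ket:
  assumes "computes \<G> w C n m f" "\<And>x. length x = n \<Longrightarrow> length (f x) = m" "t \<subseteq> {..<n + m}"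
  shows "run_circuit C (ket t) = ket (query n m f t)"
proof -
  let ?x = "input n t" and ?y = "map (\<lambda>k. n + k \<in> t) [0..<m]"
  have len: "length (f ?x) = m" using assms(2) by (simp add: input_def)
  have "?x \<in> carrier (Z2 n)" "?y \<in> carrier (Z2 m)" by (auto simp: Z2_def input_def)
  then have "run_circuit C (ket (bits_at 0 ?x \<union> bits_at n ?y)) =
      ket (bits_at 0 ?x \<union> bits_at n (?y \<otimes>\<^bsub>Z2 m\<^esub> f ?x))"
    using assms(1) by (auto simp: computes_def)
  moreover have "bits_at 0 ?x \<union> bits_at n (?y \<otimes>\<^bsub>Z2 m\<^esub> f ?x) = query n m f t"
  proof (rule Set.set_eqI)
    fix q
    have "q \<in> query n m f t \<longleftrightarrow> (q \<in> t) \<noteq> (n \<le> q \<and> q < n + m \<and> f ?x ! (q - n))"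
      by (auto simp: query_def le_iff_add)
    then show "q \<in> bits_at 0 ?x \<union> bits_at n (?y \<otimes>\<^bsub>Z2 m\<^esub> f ?x) \<longleftrightarrow> q \<in> query n m f t"
      using assms(3) len by (cases "q < n") (auto simp: bits_at_mem Z2_def input_def)
  qed
  ultimately show ?thesis by (simp add: bits_at_decode[OF assms(3)])
qed

text \<open>\<open>computes\<close> describes single basis states with clean work qubits. Linearity
  and slicing by the content of the outer qubits extend it to superpositions entangled with
  these.\<close>

lemma run_circuit_query:
  fixes \<psi> :: qstate
  assumes comp: "computes \<G> w C n m f" and len: "\<And>x. length x = n \<Longrightarrow> length (f x) = m"
    and clean: "\<And>s. \<psi> s \<noteq> 0 \<Longrightarrow> s \<inter> {n + m..<w} = {}"
  shows "run_circuit C \<psi> = \<psi> \<circ> query n m f"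
proof
  fix s
  define t e where "t = s \<inter> {..<w}" and "e = s - {..<w}"
  have s: "s = t \<union> e" and t: "t \<subseteq> {..<w}" and e: "e \<inter> {..<w} = {}"
    by (auto simp: t_def e_def)
  have nm: "n + m \<le> w" using comp by (simp add: computes_def)
  have ws: "set ws \<subseteq> {..<w}" if "(U, ws) \<in> set C" for U ws
    using comp that by (auto simp: computes_def circuit_over_def)
  let ?T = "Pow {..<n + m}"
  \<comment> \<open>Clean work qubits leave only basis states on the first \<open>n + m\<close>
    wires, so the slice is a finite combination of kets covered by
    \<open>run_circuit_ket\<close>.\<close>
  have sl: "slice w e \<psi> = (\<lambda>u. \<Sum>v\<in>?T. \<psi> (v \<union> e) * ket v u)"
  proof
    fix u
    have "(\<Sum>v\<in>?T. \<psi> (v \<union> e) * ket v u) = (if u \<in> ?T then \<psi> (u \<union> e) else 0)"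
      by (simp add: ket_def if_distrib[of "\<lambda>x. _ * x"] cong: if_cong)
    moreover have "\<psi> (u \<union> e) = 0" if "u \<subseteq> {..<w}" "\<not> u \<subseteq> {..<n + m}"
      using clean[of "u \<union> e"] that by fastforce
    moreover have "u \<subseteq> {..<w}" if "u \<in> ?T" using that nm by auto
    ultimately show "slice w e \<psi> u = (\<Sum>v\<in>?T. \<psi> (v \<union> e) * ket v u)"
      by (auto simp: slice_def)
  qed
  have qs: "query n m f u \<subseteq> {..<n + m}" if "u \<subseteq> {..<n + m}" for u
    using that by (auto simp: query_def)
  have "run_circuit C \<psi> s = slice w e (run_circuit C \<psi>) t"
    using t by (simp add: slice_def s)
  also have "\<dots> = run_circuit C (\<lambda>u. \<Sum>v\<in>?T. \<psi> (v \<union> e) * ket v u) t"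
    using run_circuit_slice[of C w e \<psi>, OF ws e] by (simp add: sl)
  also have "\<dots> = (\<Sum>v\<in>?T. \<psi> (v \<union> e) * ket (query n m f v) t)"
    unfolding run_circuit_sum
    by (intro sum.cong refl arg_cong2[of _ _ _ _ "(*)"]) (simp add: run_circuit_ket[OF comp len])
  \<comment> \<open>The equation \<open>t = query n m f v\<close> is turned around because
    \<open>query\<close> is an involution.\<close>
  also have "\<dots> = (\<Sum>v\<in>?T. if v = query n m f t then \<psi> (v \<union> e) else 0)"
    by (intro sum.cong refl) (auto simp: ket_def)
  also have "\<dots> = (if query n m f t \<in> ?T then \<psi> (query n m f t \<union> e) else 0)"
    by simp
  also have "\<dots> = \<psi> (query n m f t \<union> e)"
  proof -
    \<comment> \<open>A preimage outside the first \<open>n + m\<close> wires would have a work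
      qubit set, and there the amplitude vanishes.\<close>
    have "\<psi> (query n m f t \<union> e) = 0" if "\<not> query n m f t \<subseteq> {..<n + m}"
    proof (rule ccontr)
      assume "\<psi> (query n m f t \<union> e) \<noteq> 0"
      then have "(query n m f t \<union> e) \<inter> {n + m..<w} = {}" by (rule clean)
      moreover have "query n m f t \<subseteq> {..<w}"
        using t nm by (auto simp: query_def)
      ultimately have "query n m f t \<subseteq> {..<n + m}" by fastforce
      with that show False ..
    qed
    then show ?thesis by auto
  qed
  also have "query n m f t \<union> e = query n m f s"
  proof -
    have "input n t = input n s" using nm by (auto simp: input_def t_def)
    then show ?thesis using e nm by (fastforce simp: query_def s)
  qed
  finally show "run_circuit C \<psi> s = (\<psi> \<circ> query n m f) s" by simp
qed

section \<open>The building blocks of the program\<close>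

text \<open>Registers 0 to 9 are reserved for the parameters of the blocks, registers 10 to 19 for their local
  variables; the matrix starts at register 40.\<close>

definition frame :: "(nat \<Rightarrow> nat) \<Rightarrow> (nat \<Rightarrow> nat) \<Rightarrow> bool" where
  "frame \<sigma> \<sigma>' \<longleftrightarrow> (\<forall>r. r < 10 \<or> 20 \<le> r \<longrightarrow> \<sigma>' r = \<sigma> r)"

definition stored :: "nat \<Rightarrow> (nat \<Rightarrow> nat) \<Rightarrow> (nat \<Rightarrow> nat \<Rightarrow> bool) \<Rightarrow> bool" where
  "stored n \<sigma> B \<longleftrightarrow> (\<forall>i<n. \<forall>j<n. (\<sigma> (40 + i * n + j) \<noteq> 0) = B i j)"

lemma frame_refl [simp]: "frame \<sigma> \<sigma>"
  by (simp add: frame_def)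

lemma frame_trans: "frame \<sigma> \<sigma>' \<Longrightarrow> frame \<sigma>' \<sigma>'' \<Longrightarrow> frame \<sigma> \<sigma>''"
  by (simp add: frame_def)

lemma frame_upd [simp]: "10 \<le> r \<Longrightarrow> r < 20 \<Longrightarrow> frame \<sigma> (\<sigma>'(r := v)) \<longleftrightarrow> frame \<sigma> \<sigma>'"
  by (auto simp: frame_def)

lemma frame_low: "frame \<sigma> \<sigma>' \<Longrightarrow> r < 10 \<Longrightarrow> \<sigma>' r = \<sigma> r"
  by (simp add: frame_def)

lemma frame_high: "frame \<sigma> \<sigma>' \<Longrightarrow> 20 \<le> r \<Longrightarrow> \<sigma>' r = \<sigma> r"
  by (simp add: frame_def)

lemma frame_stored: "frame \<sigma> \<sigma>' \<Longrightarrow> stored n \<sigma>' B \<longleftrightarrow> stored n \<sigma> B"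
  by (simp add: stored_def frame_high)

definition hads :: "nat \<Rightarrow> nat \<Rightarrow> qstate \<Rightarrow> qstate" where
  "hads w k \<psi> = fold (\<lambda>i. hadamard (w + i)) [0..<k] \<psi>"

lemma hads_Suc: "hads w (Suc k) \<psi> = hadamard (w + k) (hads w k \<psi>)"
  by (simp add: hads_def)

definition had_prog :: "instr list" where
  "had_prog = [Move 13 2, Move 10 0, Loop 10 [Apply Hadamard [13], Inc 13, Dec 10]]"

text \<open>\<open>lin w E\<close> adds to the first qubits the product of the vector in the qubits \<open>w, w + 1, \<dots>\<close>
  and the matrix whose non-zero entries are at the positions in \<open>E\<close>.\<close>

definition lin :: "nat \<Rightarrow> (nat \<times> nat) set \<Rightarrow> nat set \<Rightarrow> nat set" where
  "lin w E s = tog {b. odd (card {i. (i, b) \<in> E \<and> w + i \<in> s})} s"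

definition positions :: "nat \<Rightarrow> (nat \<Rightarrow> nat \<Rightarrow> bool) \<Rightarrow> (nat \<times> nat) set" where
  "positions n B = {(i, b). i < n \<and> b < n \<and> B i b}"

text \<open>One controlled NOT per matrix entry: its target lies below \<open>w\<close>, so no bit
  of the vector changes, and only the parity at \<open>l\<close> gains the term of row
  \<open>i\<close>.\<close>

lemma lin_cnot:
  assumes "finite E" "(i, l) \<notin> E" "l < w"
  shows "lin w E (cnot (w + i) l s) = lin w (insert (i, l) E) s"
proof -
  have fin: "finite {j. (j, b) \<in> E \<and> w + j \<in> s}" for b
    by (rule finite_subset[of _ "fst ` E"]) (use assms(1) in \<open>force+\<close>)
  have "{j. (j, b) \<in> insert (i, l) E \<and> w + j \<in> s} =
      (if b = l \<and> w + i \<in> s then insert i {j. (j, b) \<in> E \<and> w + j \<in> s} else {j. (j, b) \<in> E \<and> w + j \<in> s})" for b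
    by auto
  moreover have "w + j \<in> cnot (w + i) l s \<longleftrightarrow> w + j \<in> s" for j
    using assms(3) by (auto simp: cnot_def)
  ultimately show ?thesis
    using assms(2) fin by (auto simp: lin_def cnot_def)
qed

text \<open>Register 12 runs through the entries row by row, 13 holds the controlling qubit of the
  vector and 14 the target qubit.\<close>

definition lin_prog :: "instr list" where
  "lin_prog = [Const 12 40, Move 13 2, Move 10 0,
     Loop 10 [Const 14 0, Move 11 0,
       Loop 11 [Load 15 12, Branch 15 [Apply CNot [13, 14]] [], Inc 12, Inc 14, Dec 11],
       Inc 13, Dec 10]]"

text \<open>The subroutine reads only its fixed input wires, so z B is added to them and removed
  again; \<open>lin\<close> undoes itself, since it does not change the vector that it
  reads.\<close>

definition query_prog :: "instr list" where
  "query_prog = lin_prog @ [Subroutine] @ lin_prog"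

definition zero_test :: "nat \<Rightarrow> nat \<Rightarrow> nat \<Rightarrow> nat set \<Rightarrow> nat set" where
  "zero_test n m c s = tog (if \<forall>k<m. n + k \<notin> s then {c} else {}) s"

text \<open>A Toffoli gate with its first control negated: it passes the ancilla
  \<open>a + k\<close> on to the next one if qubit \<open>n + k\<close> is 0.\<close>

definition link :: "nat \<Rightarrow> nat \<Rightarrow> nat \<Rightarrow> nat set \<Rightarrow> nat set" where
  "link n a k = tog {n + k} \<circ> toff (n + k) (a + k) (a + k + 1) \<circ> tog {n + k}"

text \<open>\<open>unchain\<close> is the inverse of \<open>chain\<close>, which sets the ancilla \<open>a + k\<close> iff the first \<open>k\<close>
  qubits from \<open>n\<close> on are 0.\<close>

fun chain :: "nat \<Rightarrow> nat \<Rightarrow> nat \<Rightarrow> nat set \<Rightarrow> nat set" where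
  "chain n a 0 = tog {a}"
| "chain n a (Suc k) = link n a k \<circ> chain n a k"

fun unchain :: "nat \<Rightarrow> nat \<Rightarrow> nat \<Rightarrow> nat set \<Rightarrow> nat set" where
  "unchain n a 0 = tog {a}"
| "unchain n a (Suc k) = unchain n a k \<circ> link n a k"

text \<open>Compute, copy, uncompute. States are pulled back, so the first loop contributes
  \<open>unchain\<close> and the second one \<open>chain\<close>.\<close>

definition zero_prog :: "instr list" where
  "zero_prog = [Move 18 0, Move 13 3, Inc 13, Move 14 13, Inc 14, Apply PauliX [13], Move 10 1,
     Loop 10 [Apply PauliX [18], Apply Toffoli [18, 13, 14], Apply PauliX [18],
       Inc 18, Inc 13, Inc 14, Dec 10],
     Apply CNot [13, 3], Move 10 1,
     Loop 10 [Dec 18, Dec 13, Dec 14,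
       Apply PauliX [18], Apply Toffoli [18, 13, 14], Apply PauliX [18], Dec 10],
     Apply PauliX [13]]"

lemma link_def_tog:
  assumes "n + k \<noteq> a + k" "n + k \<noteq> a + k + 1"
  shows "link n a k s = tog (if n + k \<notin> s \<and> a + k \<in> s then {a + k + 1} else {}) s"
  using assms by (auto simp: link_def toff_def)

lemma unchain_chain:
  assumes "n + m \<le> a" "k \<le> m"
  shows "unchain n a k (chain n a k s) = s"
  using assms(2)
proof (induction k arbitrary: s)
  case (Suc k)
  have "n + k \<noteq> a + k" "n + k \<noteq> a + k + 1" using assms Suc by auto
  note [simp] = link_def_tog[OF this]
  have "link n a k (link n a k t) = t" for t
    using assms Suc.prems by auto
  then show ?case using Suc by simp
qed simp

lemma unchain_tog:
  assumes "n + m \<le> c" "c < a" "k \<le> m"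
  shows "unchain n a k (tog {c} s) = tog {c} (unchain n a k s)"
  using assms(3)
proof (induction k arbitrary: s)
  case 0
  then show ?case by (simp add: tog_commute)
next
  case (Suc k)
  have "n + k \<noteq> a + k" "n + k \<noteq> a + k + 1" using assms Suc by auto
  note [simp] = link_def_tog[OF this]
  have "link n a k (tog {c} s) = tog {c} (link n a k s)"
    using assms Suc.prems by auto
  then show ?case using Suc by simp
qed

text \<open>By \<open>s \<subseteq> {..<a}\<close> all ancillas start as 0, so each
  \<open>link\<close> writes the next conjunction into a fresh qubit.\<close>

lemma mem_chain:
  assumes "n + m \<le> a" "k \<le> m" "s \<subseteq> {..<a}"
  shows "q \<in> chain n a k s \<longleftrightarrow> q \<in> s \<or> (\<exists>i\<le>k. q = a + i \<and> (\<forall>j<i. n + j \<notin> s))"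
  using assms(2)
proof (induction k arbitrary: q)
  case 0
  then show ?case using assms(3) by auto
next
  case (Suc k)
  have ne: "n + k \<noteq> a + k" "n + k \<noteq> a + k + 1" using assms Suc by auto
  have IH: "q \<in> chain n a k s \<longleftrightarrow> q \<in> s \<or> (\<exists>i\<le>k. q = a + i \<and> (\<forall>j<i. n + j \<notin> s))" for q
    using Suc by simp
  have a: "a + i \<notin> s" for i using assms(3) by auto
  have n: "n + k \<in> chain n a k s \<longleftrightarrow> n + k \<in> s" unfolding IH using assms Suc.prems by auto
  have ak: "a + k \<in> chain n a k s \<longleftrightarrow> (\<forall>j<k. n + j \<notin> s)" unfolding IH using a by auto
  have ak1: "a + k + 1 \<notin> chain n a k s" unfolding IH using a[of "k + 1"] by auto
  show ?case
  proof (cases "q = a + Suc k")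
    case True
    then show ?thesis using n ak ak1 a[of "Suc k"] by (auto simp: link_def_tog[OF ne] less_Suc_eq)
  next
    case False
    then have "q \<in> chain n a (Suc k) s \<longleftrightarrow> q \<in> chain n a k s" by (simp add: link_def_tog[OF ne])
    then show ?thesis using False unfolding IH by (auto simp: le_Suc_eq)
  qed
qed

text \<open>\<open>chain\<close> neither reads nor writes \<open>c\<close>, so the toggle of
  \<open>c\<close> passes through \<open>unchain\<close> and the ancillas are restored.\<close>

lemma unchain_cnot_chain:
  assumes "n + m \<le> c" "c < a" "s \<subseteq> {..<a}"
  shows "unchain n a m (cnot (a + m) c (chain n a m s)) = zero_test n m c s"
proof -
  have "a + m \<in> chain n a m s \<longleftrightarrow> (\<forall>k<m. n + k \<notin> s)"
    using assms by (subst mem_chain[of n m]) auto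
  moreover have "unchain n a m (tog {c} (chain n a m s)) = tog {c} s"
    using assms by (simp add: unchain_tog[of n m] unchain_chain[of n m])
  ultimately show ?thesis using assms
    by (simp add: cnot_def zero_test_def unchain_chain[of n m])
qed

section \<open>Correctness and running time of the Hadamard, matrix and zero-test blocks\<close>

locale layout = machine +
  fixes n m :: nat
  assumes layout: "n + m \<le> w"
begin

definition env :: "(nat \<Rightarrow> nat) \<Rightarrow> bool" where
  "env \<sigma> \<longleftrightarrow> \<sigma> 0 = n \<and> \<sigma> 1 = m \<and> \<sigma> 2 = w \<and> \<sigma> 3 = w + n \<and> \<sigma> 8 = 40 + n * n"

lemma frame_env: "frame \<sigma> \<sigma>' \<Longrightarrow> env \<sigma>' \<longleftrightarrow> env \<sigma>"
  by (simp add: env_def frame_low)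

lemma wp_PauliX:
  "0 < T \<Longrightarrow> wp A (T - 1) Q \<sigma> (\<psi> \<circ> tog {\<sigma> a}) \<Longrightarrow> wp (Apply PauliX [a] # A) T Q \<sigma> \<psi>"
  by (rule wp_Apply) (simp_all del: gate_mat.simps add: apply_PauliX)

lemma wp_Hadamard:
  "0 < T \<Longrightarrow> wp A (T - 1) Q \<sigma> (hadamard (\<sigma> a) \<psi>) \<Longrightarrow> wp (Apply Hadamard [a] # A) T Q \<sigma> \<psi>"
  by (rule wp_Apply) (simp_all del: gate_mat.simps add: apply_Hadamard)

lemma wp_CNot:
  "0 < T \<Longrightarrow> \<sigma> a \<noteq> \<sigma> b \<Longrightarrow> wp A (T - 1) Q \<sigma> (\<psi> \<circ> cnot (\<sigma> a) (\<sigma> b)) \<Longrightarrow>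
    wp (Apply CNot [a, b] # A) T Q \<sigma> \<psi>"
  by (rule wp_Apply) (simp_all del: gate_mat.simps add: apply_CNot)

lemma wp_Toffoli:
  "0 < T \<Longrightarrow> distinct [\<sigma> a, \<sigma> b, \<sigma> c] \<Longrightarrow> wp A (T - 1) Q \<sigma> (\<psi> \<circ> toff (\<sigma> a) (\<sigma> b) (\<sigma> c)) \<Longrightarrow>
    wp (Apply Toffoli [a, b, c] # A) T Q \<sigma> \<psi>"
  by (rule wp_Apply) (simp_all del: gate_mat.simps add: apply_Toffoli)

lemma wp_Loop_upto:
  assumes "\<And>k \<sigma> \<psi>. I (Suc k) \<sigma> \<psi> \<Longrightarrow> \<sigma> r = Suc k \<Longrightarrow> wp P b (\<lambda>\<sigma> \<psi>. \<sigma> r = k \<and> I k \<sigma> \<psi>) \<sigma> \<psi>"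
    and "I (\<sigma> r) \<sigma> \<psi>"
    and "\<sigma> r * (b + 1) + 1 + T' \<le> T"
    and "\<And>\<sigma> \<psi>. I 0 \<sigma> \<psi> \<Longrightarrow> \<sigma> r = 0 \<Longrightarrow> wp A T' Q \<sigma> \<psi>"
  shows "wp (Loop r P # A) T Q \<sigma> \<psi>"
  by (rule wp_mono[OF wp_Loop[where I = I, OF assms(1,4,2)] assms(3)])

lemma wp_had_prog:
  assumes "env \<sigma>0"
  shows "wp had_prog (4 * n + 3) (\<lambda>\<sigma> \<psi>. frame \<sigma>0 \<sigma> \<and> \<psi> = hads w n \<psi>0) \<sigma>0 \<psi>0"
  unfolding had_prog_def
  apply (rule wp_Move, simp)
  apply (rule wp_Move, simp)
  apply (rule wp_Loop_upto[where b = 3 and T' = 0 and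
      I = "\<lambda>k \<sigma> \<psi>. frame \<sigma>0 \<sigma> \<and> (\<exists>i. i + k = n \<and> \<sigma> 13 = w + i \<and> \<psi> = hads w i \<psi>0)"])
  subgoal for k \<sigma> \<psi>
    apply (rule wp_Hadamard, simp)
    apply (rule wp_Inc, simp)
    apply (rule wp_Dec, simp)
    apply (rule wp_Nil)
    by (auto simp: hads_Suc)
  subgoal using assms by (simp add: env_def) (simp add: hads_def)
  subgoal using assms by (simp add: env_def)
  subgoal by (rule wp_Nil) simp
  done

lemma wp_lin_prog:
  assumes env: "env \<sigma>0" and B: "stored n \<sigma>0 B"
  shows "wp lin_prog (n * (7 * n + 8) + 4)
    (\<lambda>\<sigma> \<psi>. frame \<sigma>0 \<sigma> \<and> \<psi> = \<psi>0 \<circ> lin w (positions n B)) \<sigma>0 \<psi>0"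
proof -
  define E where "E i l = {(i', b). (i' < i \<and> b < n \<or> i' = i \<and> b < l) \<and> B i' b}" for i l
  have fin: "finite (E i l)" for i l
    by (rule finite_subset[of _ "{..i} \<times> ({..<n} \<union> {..<l})"]) (auto simp: E_def)
  have E0: "E 0 0 = {}" and ES: "E i n = E (Suc i) 0" and En: "E n 0 = positions n B" for i
    by (auto simp: E_def positions_def less_Suc_eq)
  have lin0: "lin w {} = id" by (simp add: lin_def [abs_def] id_def)
  have Estep: "E i (Suc l) = (if B i l then insert (i, l) (E i l) else E i l)" "(i, l) \<notin> E i l" for i l
    by (auto simp: E_def less_Suc_eq)
  have entry: "(\<sigma>0 (40 + i * n + l) \<noteq> 0) = B i l" if "i < n" "l < n" for i l
    using B that by (simp add: stored_def)
  have step: "\<psi>0 \<circ> lin w (E i l) \<circ> cnot (w + i) l = \<psi>0 \<circ> lin w (insert (i, l) (E i l))" if "l < n" for i l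
    using lin_cnot[OF fin Estep(2)[of i l], of w] that layout by (auto simp: comp_def)
  have s0: "\<sigma>0 0 = n" "\<sigma>0 2 = w" using env by (auto simp: env_def)
  show ?thesis
    unfolding lin_prog_def
    apply (rule wp_Const, simp)
    apply (rule wp_Move, simp)
    apply (rule wp_Move, simp)
    apply (rule wp_Loop_upto[where b = "7 * n + 5" and T' = 0 and I = "\<lambda>k \<sigma> \<psi>. frame \<sigma>0 \<sigma> \<and>
        (\<exists>i. i + k = n \<and> \<sigma> 12 = 40 + i * n \<and> \<sigma> 13 = w + i \<and> \<psi> = \<psi>0 \<circ> lin w (E i 0))"])
    subgoal for k \<sigma> \<psi>
      apply (elim conjE exE)
      subgoal for i
        apply (rule wp_Const, simp)
        apply (rule wp_Move, simp)
        apply (rule wp_Loop_upto[where b = 6 and T' = 2 and I = "\<lambda>k' \<sigma> \<psi>. frame \<sigma>0 \<sigma> \<and> \<sigma> 10 = Suc k \<and>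
          \<sigma> 13 = w + i \<and>
          (\<exists>l. l + k' = n \<and> \<sigma> 12 = 40 + i * n + l \<and> \<sigma> 14 = l \<and> \<psi> = \<psi>0 \<circ> lin w (E i l))"])
        subgoal for k' \<sigma>' \<psi>'
          apply (elim conjE exE)
          subgoal for l
            apply (rule wp_Load, simp)
            apply (rule wp_Branch, simp)
            subgoal
              apply simp
              apply (rule wp_CNot, simp, use layout in simp)
              apply (rule wp_Inc, simp)
              apply (rule wp_Inc, simp)
              apply (rule wp_Dec, simp)
              apply (rule wp_Nil)
              using entry[of i l] Estep(1)[of i l] step[of l i]
              by (auto simp: frame_high intro!: exI[of _ "Suc l"])
            subgoal
              apply simp
              apply (rule wp_Inc, simp)
              apply (rule wp_Inc, simp)
              apply (rule wp_Dec, simp)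
              apply (rule wp_Nil)
              using entry[of i l] Estep(1)[of i l]
              by (auto simp: frame_high intro!: exI[of _ "Suc l"])
            done
          done
        subgoal by (simp add: frame_low s0)
        subgoal by (simp add: frame_low s0)
        subgoal for \<sigma>' \<psi>'
          apply (elim conjE exE)
          apply (rule wp_Inc, simp)
          apply (rule wp_Dec, simp)
          apply (rule wp_Nil)
          by (auto simp: ES intro!: exI[of _ "Suc i"])
        done
      done
    subgoal by (simp add: s0 E0 lin0)
    subgoal by (simp add: s0 algebra_simps)
    subgoal by (rule wp_Nil) (auto simp: En)
    done
qed

lemma wp_zero_prog:
  assumes env: "env \<sigma>0" and supp: "\<And>s. \<psi>0 s \<noteq> 0 \<Longrightarrow> s \<subseteq> {..<w + n + 1}"
  shows "wp zero_prog (16 * m + 12)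
    (\<lambda>\<sigma> \<psi>. frame \<sigma>0 \<sigma> \<and> \<psi> = \<psi>0 \<circ> zero_test n m (w + n)) \<sigma>0 \<psi>0"
proof -
  define a c where "a = w + n + 1" and "c = w + n"
  have ac: "n + m \<le> c" "c < a" "n + m \<le> a" using layout by (auto simp: a_def c_def)
  define \<psi>1 where "\<psi>1 = \<psi>0 \<circ> unchain n a m \<circ> cnot (a + m) c"
  have s0: "\<sigma>0 0 = n" "\<sigma>0 1 = m" "\<sigma>0 2 = w" "\<sigma>0 3 = c" using env by (auto simp: env_def c_def)
  have *: "\<psi> \<circ> tog {n + i} \<circ> toff (n + i) (a + i) (a + i + 1) \<circ> tog {n + i} = \<psi> \<circ> link n a i" for i \<psi>
    by (simp add: link_def comp_assoc)
  have final: "\<psi>1 \<circ> chain n a m = \<psi>0 \<circ> zero_test n m c"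
  proof
    fix s
    show "(\<psi>1 \<circ> chain n a m) s = (\<psi>0 \<circ> zero_test n m c) s"
    proof (cases "s \<subseteq> {..<a}")
      case True
      then show ?thesis
        using ac by (simp add: \<psi>1_def unchain_cnot_chain[of n m c a])
    next
      \<comment> \<open>If a qubit from \<open>a\<close> on is set, both sides are 0: each argument
        of \<open>\<psi>0\<close> is \<open>s\<close> or \<open>tog {c} s\<close>, and neither lies
        in \<open>{..<a}\<close>, which contains the support.\<close>
      case False
      have "unchain n a m (cnot (a + m) c (chain n a m s)) \<in> {s, tog {c} s}"
        using ac by (auto simp: cnot_def unchain_tog[of n m c a] unchain_chain[of n m a])
      moreover have nsub: "\<not> tog {c} s \<subseteq> {..<a}"
      proof -
        obtain t where "t \<in> s" "\<not> t < a" using False by auto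
        moreover from this have "t \<noteq> c" using ac by auto
        ultimately show ?thesis by (auto intro!: exI[of _ t] simp: subset_iff)
      qed
      ultimately have "\<psi>0 (unchain n a m (cnot (a + m) c (chain n a m s))) = 0"
        using supp[folded a_def] False by blast
      moreover have "zero_test n m c s \<in> {s, tog {c} s}" by (auto simp: zero_test_def)
      then have "\<psi>0 (zero_test n m c s) = 0"
        using supp[folded a_def] False nsub by blast
      ultimately show ?thesis by (simp add: \<psi>1_def)
    qed
  qed
  show ?thesis
    unfolding zero_prog_def
    apply (rule wp_Move, simp)
    apply (rule wp_Move, simp)
    apply (rule wp_Inc, simp)
    apply (rule wp_Move, simp)
    apply (rule wp_Inc, simp)
    apply (rule wp_PauliX, simp)
    apply (rule wp_Move, simp)
    apply (rule wp_Loop_upto[where b = 7 and T' = "8 * m + 4" and I = "\<lambda>k \<sigma> \<psi>. frame \<sigma>0 \<sigma> \<and>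
        (\<exists>i. i + k = m \<and> \<sigma> 18 = n + i \<and> \<sigma> 13 = a + i \<and> \<sigma> 14 = a + i + 1 \<and> \<psi> = \<psi>0 \<circ> unchain n a i)"])
    subgoal for k \<sigma> \<psi>
      apply (elim conjE exE)
      subgoal for i
        apply (rule wp_PauliX, simp)
        apply (rule wp_Toffoli, simp, use ac in simp)
        apply (rule wp_PauliX, simp)
        apply (rule wp_Inc, simp)
        apply (rule wp_Inc, simp)
        apply (rule wp_Inc, simp)
        apply (rule wp_Dec, simp)
        apply (rule wp_Nil)
        using *[of "\<psi>0 \<circ> unchain n a i" i]
        by (auto simp: comp_assoc intro!: exI[of _ "Suc i"])
      done
    subgoal using s0 by (simp add: a_def c_def)
    subgoal using s0 by simp
    subgoal for \<sigma> \<psi>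
      apply (elim conjE exE)
      apply (rule wp_CNot, simp, use ac in \<open>simp add: frame_low s0\<close>)
      apply (rule wp_Move, simp)
      \<comment> \<open>The invariant records what is still to be composed with the state; at
        \<open>k = 0\<close> only the last X gate, \<open>chain n a 0\<close>, is missing.\<close>
      apply (rule wp_Loop_upto[where b = 7 and T' = 1 and I = "\<lambda>k \<sigma> \<psi>. frame \<sigma>0 \<sigma> \<and>
        k \<le> m \<and> \<sigma> 18 = n + k \<and> \<sigma> 13 = a + k \<and> \<sigma> 14 = a + k + 1 \<and>
        \<psi> \<circ> chain n a k = \<psi>1 \<circ> chain n a m"])
      subgoal for _ k \<sigma> \<psi>
        apply (elim conjE)
        apply (rule wp_Dec, simp)
        apply (rule wp_Dec, simp)
        apply (rule wp_Dec, simp)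
        apply (rule wp_PauliX, simp)
        apply (rule wp_Toffoli, simp, use ac in simp)
        apply (rule wp_PauliX, simp)
        apply (rule wp_Dec, simp)
        apply (rule wp_Nil)
        using *[of \<psi> k]
        by (auto simp: comp_assoc)
      subgoal using s0 by (simp add: frame_low \<psi>1_def comp_assoc)
      subgoal using s0 by (simp add: frame_low)
      subgoal for \<sigma> \<psi>
        apply (elim conjE)
        apply (rule wp_PauliX, simp)
        apply (rule wp_Nil)
        using final by (simp add: c_def)
      done
    done
qed

end

section \<open>Vectors over the two-element field\<close>

definition comb :: "nat \<Rightarrow> (nat \<Rightarrow> nat \<Rightarrow> bool) \<Rightarrow> nat set \<Rightarrow> bool list" where
  "comb n B I = map (\<lambda>l. odd (card {i \<in> I. B i l})) [0..<n]"

definition bit_row :: "nat \<Rightarrow> (nat \<Rightarrow> nat \<Rightarrow> bool) \<Rightarrow> nat \<Rightarrow> bool list" where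
  "bit_row n B i = map (B i) [0..<n]"

lemma length_comb [simp]: "length (comb n B I) = n"
  by (simp add: comb_def)

lemma odd_card_tog:
  assumes "finite I" "finite J"
  shows "odd (card (tog J I)) \<longleftrightarrow> odd (card I) \<noteq> odd (card J)"
  using assms(2)
proof (induction J rule: finite_induct)
  case (insert x J)
  have fin: "finite (tog J I)"
    by (rule finite_subset[of _ "I \<union> J"]) (use assms insert in auto)
  have "tog (insert x J) I = (if x \<in> I then tog J I - {x} else insert x (tog J I))"
    using insert.hyps(2) by auto
  moreover have "x \<in> tog J I \<longleftrightarrow> x \<in> I" using insert.hyps(2) by simp
  moreover have "0 < card (tog J I)" if "x \<in> tog J I" using that fin card_gt_0_iff by blast
  ultimately have "odd (card (tog (insert x J) I)) \<longleftrightarrow> even (card (tog J I))"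
    using fin by (auto simp: card_Diff_singleton)
  then show ?case using insert.IH insert.hyps by auto
qed simp

lemma comb_tog:
  assumes "finite I" "finite J"
  shows "comb n B (tog J I) = map2 (\<noteq>) (comb n B I) (comb n B J)"
proof -
  have "{i \<in> tog J I. B i l} = tog {i \<in> J. B i l} {i \<in> I. B i l}" for l by auto
  then show ?thesis using assms by (auto simp: comb_def odd_card_tog intro!: nth_equalityI)
qed

lemma comb_empty: "comb n B {} = replicate n False"
  by (simp add: comb_def map_replicate_trivial)

lemma comb_singleton: "comb n B {i} = bit_row n B i"
proof -
  have "{k. k = i \<and> B k l} = (if B i l then {i} else {})" for l by auto
  then show ?thesis by (simp add: comb_def bit_row_def)
qed

text \<open>Adding \<open>y i\<close> times \<open>b\<close> to every row adds \<open>b\<close> to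
  the combination as often as \<open>y\<close> is true on \<open>I\<close>. For even parity the same
  coefficients \<open>I\<close> therefore still represent the same vector.\<close>

lemma comb_update:
  assumes "finite I"
  shows "comb n (\<lambda>i l. B i l \<noteq> (y i \<and> b l)) I =
    (if odd (card {i \<in> I. y i}) then map2 (\<noteq>) (comb n B I) (map b [0..<n]) else comb n B I)"
proof -
  have "odd (card {i \<in> I. B i l \<noteq> (y i \<and> b l)}) =
      (odd (card {i \<in> I. B i l}) \<noteq> (odd (card {i \<in> I. y i}) \<and> b l))" for l
  proof -
    have "{i \<in> I. B i l \<noteq> (y i \<and> b l)} = (if b l then tog {i \<in> I. y i} {i \<in> I. B i l} else {i \<in> I. B i l})"
      by auto
    moreover have "finite {i \<in> I. P i}" for P using assms by simp
    ultimately show ?thesis by (auto simp: odd_card_tog)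
  qed
  then show ?thesis by (simp add: comb_def) (auto intro!: nth_equalityI)
qed

lemma group_Z2: "group (Z2 n)"
proof (rule groupI)
  fix x assume "x \<in> carrier (Z2 n)"
  then show "\<exists>y\<in>carrier (Z2 n). y \<otimes>\<^bsub>Z2 n\<^esub> x = \<one>\<^bsub>Z2 n\<^esub>"
    by (intro bexI[of _ x]) (auto simp: Z2_def intro!: nth_equalityI)
qed (auto simp: Z2_def intro!: nth_equalityI)

lemma generate_rows:
  assumes sub: "subgroup H (Z2 n)" and rows: "\<And>i. i < n \<Longrightarrow> bit_row n B i \<in> H"
    and span: "\<And>h. h \<in> H \<Longrightarrow> \<exists>I\<subseteq>{..<n}. h = comb n B I"
  shows "generate (Z2 n) {bit_row n B i | i. i < n} = H"
proof
  show "generate (Z2 n) {bit_row n B i | i. i < n} \<subseteq> H"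
    by (rule group.generate_subgroup_incl[OF group_Z2 _ sub]) (use rows in auto)
  have "comb n B I \<in> generate (Z2 n) {bit_row n B i | i. i < n}" if "I \<subseteq> {..<n}" for I
  proof -
    have "finite I" using that finite_subset by blast
    then show ?thesis using that
    proof (induction I rule: finite_induct)
      case empty
      have "comb n B {} = \<one>\<^bsub>Z2 n\<^esub>" by (simp add: comb_empty Z2_def)
      then show ?case by (simp only: generate.one)
    next
      case (insert i I)
      have "insert i I = tog {i} I" using insert.hyps(2) by auto
      then have "comb n B (insert i I) = comb n B I \<otimes>\<^bsub>Z2 n\<^esub> bit_row n B i"
        using insert.hyps(1) by (simp add: comb_tog comb_singleton Z2_def)
      moreover have "bit_row n B i \<in> generate (Z2 n) {bit_row n B i | i. i < n}"
        using insert.prems by (intro generate.incl) auto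
      ultimately show ?case using insert by (simp add: generate.eng)
    qed
  qed
  then show "H \<subseteq> generate (Z2 n) {bit_row n B i | i. i < n}" using span by blast
qed

section \<open>Preparing the superposition\<close>

lemma stab_hads:
  assumes "finite h" "finite k" "h \<inter> k = {}" "stab h k \<epsilon> \<psi>"
  shows "stab ((h - {w..<w+i}) \<union> (k \<inter> {w..<w+i})) ((k - {w..<w+i}) \<union> (h \<inter> {w..<w+i})) \<epsilon> (hads w i \<psi>)"
proof (induction i)
  case 0
  then show ?case using assms by (simp add: hads_def)
next
  case (Suc i)
  let ?Z = "{w..<w+i}" and ?q = "w + i"
  let ?h = "(h - ?Z) \<union> (k \<inter> ?Z)" and ?k = "(k - ?Z) \<union> (h \<inter> ?Z)"
  have "stab ((?h - {?q}) \<union> (?k \<inter> {?q})) ((?k - {?q}) \<union> (?h \<inter> {?q})) \<epsilon> (hadamard ?q (hads w i \<psi>))"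
    by (rule stab_hadamard) (use Suc assms in auto)
  moreover have "(?h - {?q}) \<union> (?k \<inter> {?q}) = (h - {w..<w+Suc i}) \<union> (k \<inter> {w..<w+Suc i})"
    "(?k - {?q}) \<union> (?h \<inter> {?q}) = (k - {w..<w+Suc i}) \<union> (h \<inter> {w..<w+Suc i})"
    by (auto simp: less_Suc_eq)
  ultimately show ?case by (simp only: hads_Suc)
qed

lemma good_hads: "finite A \<Longrightarrow> good A \<psi> \<Longrightarrow> {w..<w+i} \<subseteq> A \<Longrightarrow> good A (hads w i \<psi>)"
proof (induction i)
  case (Suc i)
  have "{w..<w+i} \<subseteq> A" "w + i \<in> A" using Suc.prems(3) by (auto simp: subset_iff)
  then show ?case unfolding hads_Suc using Suc by (intro good_hadamard) auto
qed (simp add: hads_def)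

lemma good_mono:
  assumes "finite A'" "A \<subseteq> A'" "good A \<psi>"
  shows "good A' \<psi>"
proof -
  have "(\<Sum>s \<in> Pow A. (cmod (\<psi> s))\<^sup>2) = (\<Sum>s \<in> Pow A'. (cmod (\<psi> s))\<^sup>2)"
    by (rule sum.mono_neutral_left) (use assms in \<open>auto dest: good_subset\<close>)
  then show ?thesis using assms by (auto simp: good_def)
qed

lemma good_vacuum:
  assumes "finite A" "good A \<psi>" "\<And>s. \<psi> s \<noteq> 0 \<Longrightarrow> s = {}"
  shows "good {} \<psi>"
proof -
  have "(\<Sum>s \<in> {{}}. (cmod (\<psi> s))\<^sup>2) = (\<Sum>s \<in> Pow A. (cmod (\<psi> s))\<^sup>2)"
    by (rule sum.mono_neutral_left) (use assms in auto)
  then show ?thesis using assms by (auto simp: good_def)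
qed

definition prepared :: "nat \<Rightarrow> nat \<Rightarrow> qstate \<Rightarrow> qstate" where
  "prepared w n \<psi> = hadamard (w + n) (hads w n \<psi> \<circ> tog {w + n})"

text \<open>The vacuum is fixed by every Z-type operator. Hadamard gates turn these into
  translations of z, and the X gate on the control first makes the eigenvalue of its Z operator -1.
  Only the support of \<psi> is assumed, since a reset leaves an unknown phase.\<close>

lemma prepared:
  assumes "finite A" "good A \<psi>" and vac: "\<And>s. \<psi> s \<noteq> 0 \<Longrightarrow> s = {}"
  shows "good {w..w + n} (prepared w n \<psi>)"
    and "h \<subseteq> {w..<w + n} \<Longrightarrow> prepared w n \<psi> (tog h s) = prepared w n \<psi> s"
    and "prepared w n \<psi> (tog {w + n} s) = - prepared w n \<psi> s"
proof -
  have "good {w..w + n} \<psi>"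
    by (rule good_mono[OF _ _ good_vacuum[OF assms]]) auto
  then show "good {w..w + n} (prepared w n \<psi>)"
    unfolding prepared_def
    by (intro good_hadamard good_comp_tog_const good_hads) auto
  have vst: "stab {} h 1 \<psi>" for h
  proof -
    have "parity_sign h s * \<psi> s = \<psi> s" for s
      using vac[of s] by (cases "\<psi> s = 0") (auto simp: parity_sign_def)
    then show ?thesis by (simp add: stab_def)
  qed
  show "prepared w n \<psi> (tog h s) = prepared w n \<psi> s" if h: "h \<subseteq> {w..<w + n}" for s
  proof -
    have fin: "finite h" using h finite_subset by blast
    have "stab h {} 1 (hads w n \<psi>)"
      using stab_hads[of "{}" h 1 \<psi> w n] vst fin h by (simp add: Int_absorb2 Diff_eq_empty_iff[THEN iffD2])
    then have "stab h {} 1 (hads w n \<psi> \<circ> tog {w + n})"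
      by (simp add: stab_def parity_sign_def tog_commute[of "{w + n}"])
    then have "stab ((h - {w + n}) \<union> ({} \<inter> {w + n})) (({} - {w + n}) \<union> (h \<inter> {w + n})) 1 (prepared w n \<psi>)"
      unfolding prepared_def by (intro stab_hadamard) auto
    moreover have "h - {w + n} = h" "h \<inter> {w + n} = {}" using h by auto
    ultimately have "stab h {} 1 (prepared w n \<psi>)" by simp
    then show ?thesis by (simp add: stab_def parity_sign_def)
  qed
  have "stab {} {w + n} 1 (hads w n \<psi>)"
  proof -
    have "{w + n} - {w..<w + n} = {w + n}" by auto
    then show ?thesis using stab_hads[of "{}" "{w + n}" 1 \<psi> w n] vst by simp
  qed
  moreover have ps: "parity_sign {w + n} t = (if w + n \<in> t then - 1 else 1)" for t
    by (simp add: parity_sign_def)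
  ultimately have eq: "(if w + n \<in> t then - 1 else 1) * hads w n \<psi> t = hads w n \<psi> t" for t
    by (simp add: stab_def)
  have "stab {} {w + n} (- 1) (hads w n \<psi> \<circ> tog {w + n})"
    unfolding stab_def ps
  proof
    fix s
    show "(if w + n \<in> s then - 1 else 1) * (hads w n \<psi> \<circ> tog {w + n}) (tog {} s) =
        - 1 * (hads w n \<psi> \<circ> tog {w + n}) s"
      using eq[of "tog {w + n} s"] by (cases "w + n \<in> s") auto
  qed
  then have "stab (({} - {w + n}) \<union> ({w + n} \<inter> {w + n})) (({w + n} - {w + n}) \<union> ({} \<inter> {w + n})) (- 1) (prepared w n \<psi>)"
    unfolding prepared_def by (intro stab_hadamard) auto
  then show "prepared w n \<psi> (tog {w + n} s) = - prepared w n \<psi> s"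
    by (simp add: stab_def parity_sign_def)
qed

section \<open>Analysis of a round\<close>

locale simon_round =
  fixes n m w :: nat and H :: "bool list set" and f :: "bool list \<Rightarrow> bool list"
  assumes nm: "n + m \<le> w"
    and sub: "subgroup H (Z2 n)"
    and len: "\<And>x. length x = n \<Longrightarrow> length (f x) = m"
    and promise: "\<And>x y. length x = n \<Longrightarrow> length y = n \<Longrightarrow> f x = f y \<longleftrightarrow> map2 (\<noteq>) x y \<in> H"
begin

definition zset :: "nat set \<Rightarrow> nat set" where
  "zset s = {i. i < n \<and> w + i \<in> s}"

text \<open>The content of the input wires is included, although it is 0 in the states that occur,
  so that \<open>lin_query_lin\<close> holds for every basis state without a side condition.\<close>

definition val :: "(nat \<Rightarrow> nat \<Rightarrow> bool) \<Rightarrow> nat set \<Rightarrow> bool list" where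
  "val B s = f (map2 (\<noteq>) (input n s) (comb n B (zset s)))"

definition evaluate :: "(nat \<Rightarrow> nat \<Rightarrow> bool) \<Rightarrow> nat set \<Rightarrow> nat set" where
  "evaluate B s = tog {n + k | k. k < m \<and> val B s ! k} s"

lemma finite_zset [simp]: "finite (zset s)"
  by (simp add: zset_def)

lemma length_input [simp]: "length (input n s) = n"
  by (simp add: input_def)

lemma lin_query_lin: "lin w (positions n B) (query n m f (lin w (positions n B) s)) = evaluate B s"
proof -
  have lin: "lin w (positions n B) t = tog {b. b < n \<and> comb n B (zset t) ! b} t" for t
  proof -
    have "{i. (i, b) \<in> positions n B \<and> w + i \<in> t} = (if b < n then {i \<in> zset t. B i b} else {})" for b
      by (auto simp: positions_def zset_def)
    then show ?thesis
      unfolding lin_def by (intro arg_cong2[of _ _ _ _ tog]) (auto simp: comb_def)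
  qed
  let ?t = "lin w (positions n B) s"
  have z: "zset (query n m f ?t) = zset s"
    using nm by (auto simp: zset_def query_def lin)
  have "input n ?t = map2 (\<noteq>) (input n s) (comb n B (zset s))"
    by (auto simp: lin input_def intro!: nth_equalityI)
  then have "query n m f ?t = tog {n + k | k. k < m \<and> val B s ! k} ?t"
    by (simp add: query_def val_def)
  then have "lin w (positions n B) (query n m f ?t) =
      tog {b. b < n \<and> comb n B (zset s) ! b} (tog {n + k | k. k < m \<and> val B s ! k} ?t)"
    using z lin by simp
  then show ?thesis by (simp add: evaluate_def tog_commute lin)
qed

lemma val_tog_other:
  assumes "h \<inter> ({..<n} \<union> {w..<w + n}) = {}"
  shows "val B (tog h s) = val B s"
proof -
  have "zset (tog h s) = zset s" using assms by (auto simp: zset_def)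
  moreover have "input n (tog h s) = input n s" using assms by (intro input_tog) auto
  ultimately show ?thesis by (simp add: val_def)
qed

text \<open>Translating z by the coordinates in \<open>I\<close> adds \<open>comb n B I\<close> to
  the argument of \<open>f\<close>, and the promise decides whether the value changes.\<close>

lemma val_tog_iff:
  assumes "I \<subseteq> {..<n}"
  shows "val B (tog ((+) w ` I) s) = val B s \<longleftrightarrow> comb n B I \<in> H"
proof -
  have fin: "finite I" using assms finite_subset by blast
  have "zset (tog ((+) w ` I) s) = tog I (zset s)" using assms by (auto simp: zset_def)
  moreover have "input n (tog ((+) w ` I) s) = input n s" using nm by (intro input_tog) auto
  moreover have "map2 (\<noteq>) (map2 (\<noteq>) x (map2 (\<noteq>) y z)) (map2 (\<noteq>) x y) = z"
    if "length x = n" "length y = n" "length z = n" for x y z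
    using that by (auto intro!: nth_equalityI)
  ultimately show ?thesis using fin by (simp add: val_def promise comb_tog)
qed

lemma length_val: "length (val B s) = m"
  by (simp add: val_def len)

lemma evaluate_evaluate [simp]: "evaluate B (evaluate B s) = s"
proof -
  have "val B (evaluate B s) = val B s"
    unfolding evaluate_def by (rule val_tog_other) (use nm in auto)
  then show ?thesis by (simp add: evaluate_def)
qed

lemma evaluate_tog:
  assumes "h \<inter> ({..<n} \<union> {w..<w + n}) = {}"
  shows "evaluate B (tog h s) = tog h (evaluate B s)"
  by (simp add: evaluate_def val_tog_other[OF assms] tog_commute)

definition matches :: "(nat \<Rightarrow> nat \<Rightarrow> bool) \<Rightarrow> nat set \<Rightarrow> bool" where
  "matches B s \<longleftrightarrow> (\<forall>k<m. (n + k \<in> s) = val B s ! k)"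

lemma matches_iff: "matches B s \<longleftrightarrow> (\<forall>k<m. n + k \<notin> evaluate B s)"
  by (auto simp: matches_def evaluate_def)

text \<open>The permutation part of a round, read as a preimage map: the innermost
  \<open>evaluate\<close> is the last one executed.\<close>

definition round_map :: "(nat \<Rightarrow> nat \<Rightarrow> bool) \<Rightarrow> nat \<Rightarrow> nat set \<Rightarrow> nat set" where
  "round_map B j s =
     evaluate B (cnot (w + n) (w + j) (evaluate B (zero_test n m (w + n) (evaluate B s))))"

text \<open>Conjugation by \<open>evaluate\<close> turns the test whether r is empty into
  \<open>matches\<close>, the test whether r holds the value at the current z.\<close>

lemma round_map_eq:
  "round_map B j s =
     evaluate B (cnot (w + n) (w + j) (tog (if matches B s then {w + n} else {}) s))"
proof -
  have "evaluate B (zero_test n m (w + n) (evaluate B s)) = tog (if matches B s then {w + n} else {}) s"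
    using nm by (simp add: zero_test_def matches_iff evaluate_tog)
  then show ?thesis by (simp add: round_map_def)
qed

text \<open>A translation whose combination of rows lies in \<open>H\<close> changes neither the
  value nor the control, so it commutes with every factor.\<close>

lemma round_map_shift:
  assumes "I \<subseteq> {..<n}" "comb n B I \<in> H"
  shows "round_map B j (tog ((+) w ` I) s) = tog ((+) w ` I) (round_map B j s)"
proof -
  let ?h = "(+) w ` I"
  have v: "val B (tog ?h t) = val B t" for t
    using assms val_tog_iff by simp
  have "n + k \<notin> ?h" if "k < m" for k using nm that by auto
  then have "matches B (tog ?h s) \<longleftrightarrow> matches B s" by (auto simp: matches_def v)
  moreover have "evaluate B (tog ?h t) = tog ?h (evaluate B t)" for t
    by (simp add: evaluate_def v tog_commute)
  moreover have "w + n \<notin> ?h" using assms by auto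
  ultimately show ?thesis
    by (simp add: round_map_eq cnot_def tog_commute[of "{w + n}" ?h] tog_commute[of "{w + j}" ?h])
qed

text \<open>If row \<open>j\<close> is not in \<open>H\<close>, at most one of \<open>s\<close> and its neighbour along \<open>j\<close> matches, and the
  states with non-zero amplitude are those with qubit \<open>w + n\<close> set for which exactly one does.\<close>

lemma round_map_neighbour:
  fixes \<phi> :: qstate
  assumes j: "j < n" "bit_row n B j \<notin> H"
    and supp: "\<And>s. \<phi> s \<noteq> 0 \<Longrightarrow> s \<subseteq> {w..w + n}"
    and sgn: "\<And>s. \<phi> (tog {w + n} s) = - \<phi> s"
  shows "\<phi> (round_map B j (tog {w + j} s)) = - \<phi> (round_map B j s)"
proof -
  let ?c = "w + n" and ?z = "w + j"
  have v: "val B (tog {?z} t) \<noteq> val B t" for t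
    using val_tog_iff[of "{j}" B t] j by (simp add: comb_singleton)
  have vc: "val B (tog {?c} t) = val B t" for t
    by (rule val_tog_other) (use nm in auto)
  have ec: "evaluate B (tog {?c} t) = tog {?c} (evaluate B t)" for t
    by (rule evaluate_tog) (use nm in auto)
  have cz: "?c \<noteq> ?z" using j by simp
  have mem: "n + k \<in> tog {?z} t \<longleftrightarrow> n + k \<in> t" "n + k \<in> tog {?c} t \<longleftrightarrow> n + k \<in> t" if "k < m" for k t
    using nm that by auto
  have excl: "\<not> (matches B t \<and> matches B (tog {?z} t))" for t
  proof
    assume a: "matches B t \<and> matches B (tog {?z} t)"
    have "val B (tog {?z} t) = val B t"
    proof (rule nth_equalityI)
      fix k assume "k < length (val B (tog {?z} t))"
      then have "k < m" by (simp add: length_val)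
      with a mem show "val B (tog {?z} t) ! k = val B t ! k" by (auto simp: matches_def)
    qed (simp add: length_val)
    with v show False by blast
  qed
  have mc: "matches B (tog {?c} t) \<longleftrightarrow> matches B t" for t
    using mem by (auto simp: matches_def vc)
  have zero: "\<phi> (evaluate B t) = 0" if no_match: "\<not> matches B t" for t
  proof (rule ccontr)
    assume "\<phi> (evaluate B t) \<noteq> 0"
    then have "evaluate B t \<subseteq> {w..w + n}" by (rule supp)
    moreover obtain k where "k < m" "n + k \<in> evaluate B t" using no_match unfolding matches_iff by blast
    ultimately show False using nm by (auto simp: subset_iff)
  qed
  \<comment> \<open>The control ends as 1: a basis state with control 0 would come from one with a
    non-empty r, which has amplitude 0 before the round.\<close>
  have clear: "\<phi> (round_map B j t) = 0" if "?c \<notin> t" for t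
  proof (cases "matches B t")
    case True
    then have "round_map B j t = evaluate B (tog {?z} (tog {?c} t))"
      using that by (simp add: round_map_eq cnot_def)
    moreover have "\<not> matches B (tog {?z} (tog {?c} t))"
      using excl[of "tog {?c} t"] mc[of t] True by simp
    ultimately show ?thesis using zero by simp
  next
    case False
    then have "round_map B j t = evaluate B t" using that by (simp add: round_map_eq cnot_def)
    then show ?thesis using zero False by simp
  qed
  have set_match: "round_map B j t = tog {?c} (evaluate B t)" if "?c \<in> t" "matches B t" for t
    using that by (simp add: round_map_eq cnot_def ec)
  have set_nomatch: "round_map B j t = evaluate B (tog {?z} t)" if "?c \<in> t" "\<not> matches B t" for t
    using that by (simp add: round_map_eq cnot_def)
  let ?s' = "tog {?z} s"
  have cs': "?c \<in> ?s' \<longleftrightarrow> ?c \<in> s" using cz by simp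
  show ?thesis
  proof (cases "?c \<in> s")
    case False
    then show ?thesis using clear cs' by simp
  next
    case True
    consider "matches B s" "\<not> matches B ?s'" | "\<not> matches B s" "matches B ?s'"
      | "\<not> matches B s" "\<not> matches B ?s'" using excl by blast
    then show ?thesis
    proof cases
      \<comment> \<open>\<open>s\<close> comes from control 0 with z unshifted, its neighbour from
        control 1 with z shifted. The two preimages differ only in the control, so
        \<open>sgn\<close> gives opposite signs.\<close>
      case 1
      then show ?thesis using True cs' by (simp add: set_match set_nomatch sgn)
    next
      case 2
      then show ?thesis using True cs' by (simp add: set_match set_nomatch sgn)
    next
      case 3
      then show ?thesis using True cs' zero by (simp add: set_nomatch)
    qed
  qed
qed

definition round_state :: "(nat \<Rightarrow> nat \<Rightarrow> bool) \<Rightarrow> nat \<Rightarrow> qstate \<Rightarrow> qstate" where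
  "round_state B j \<psi> = hads w n (prepared w n \<psi> \<circ> round_map B j)"

lemma round_state:
  assumes "finite A" "good A \<psi>" and vac: "\<And>s. \<psi> s \<noteq> 0 \<Longrightarrow> s = {}"
    and j: "j < n" and s: "round_state B j \<psi> s \<noteq> 0"
  shows "I \<subseteq> {..<n} \<Longrightarrow> comb n B I \<in> H \<Longrightarrow> even (card {i \<in> I. w + i \<in> s})"
    and "bit_row n B j \<notin> H \<Longrightarrow> w + j \<in> s"
proof -
  have prep: "good {w..w + n} (prepared w n \<psi>)"
    "\<And>h s. h \<subseteq> {w..<w + n} \<Longrightarrow> prepared w n \<psi> (tog h s) = prepared w n \<psi> s"
    "\<And>s. prepared w n \<psi> (tog {w + n} s) = - prepared w n \<psi> s"
    using prepared[OF assms(1,2)] vac by simp_all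
  \<comment> \<open>The last Hadamard layer turns an eigenvalue under translation into one of a
    Z-type operator, which is the common parity of all basis states in the support.\<close>
  have transfer: "parity_sign h s = \<epsilon>" if h: "h \<subseteq> {w..<w + n}"
    and st: "\<And>s. prepared w n \<psi> (round_map B j (tog h s)) = \<epsilon> * prepared w n \<psi> (round_map B j s)" for h \<epsilon>
  proof -
    have fin: "finite h" using h finite_subset by blast
    have "stab h {} \<epsilon> (prepared w n \<psi> \<circ> round_map B j)"
      using st by (simp add: stab_def parity_sign_def)
    then have "stab {} h \<epsilon> (round_state B j \<psi>)"
      unfolding round_state_def
      using stab_hads[of h "{}" \<epsilon> _ w n] fin h by (simp add: Int_absorb2 Diff_eq_empty_iff[THEN iffD2])
    then show ?thesis using s unfolding stab_def by (metis mult_right_cancel tog_empty)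
  qed
  show "even (card {i \<in> I. w + i \<in> s})" if I: "I \<subseteq> {..<n}" "comb n B I \<in> H"
  proof -
    have "parity_sign ((+) w ` I) s = 1"
    proof (rule transfer)
      show "(+) w ` I \<subseteq> {w..<w + n}" using I(1) by auto
      then show "prepared w n \<psi> (round_map B j (tog ((+) w ` I) s)) =
          1 * prepared w n \<psi> (round_map B j s)" for s
        using I by (simp add: round_map_shift prep(2))
    qed
    moreover have "s \<inter> (+) w ` I = (+) w ` {i \<in> I. w + i \<in> s}" by auto
    ultimately show ?thesis
      by (auto simp: parity_sign_def card_image split: if_splits)
  qed
  show "w + j \<in> s" if "bit_row n B j \<notin> H"
  proof -
    have "parity_sign {w + j} s = - 1"
    proof (rule transfer)
      show "prepared w n \<psi> (round_map B j (tog {w + j} s)) = - 1 * prepared w n \<psi> (round_map B j s)" for s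
        using round_map_neighbour[where \<phi> = "prepared w n \<psi>", OF j that] good_subset[OF prep(1)] prep(3) by simp
    qed (use j in simp)
    then show ?thesis by (cases "w + j \<in> s") (simp_all add: parity_sign_def)
  qed
qed

end

section \<open>The algorithm\<close>

text \<open>Besides the registers of \<open>env\<close>, register 5 holds the address of row \<open>j\<close> of the matrix (of row
  \<open>j + 1\<close> from \<open>update_prog\<close> on), 6 the qubit \<open>w + j\<close> and 7 the number of rounds left. The rows are
  updated from the last one down: row \<open>j\<close> itself may be overwritten, but the outcomes for the rows
  before it are 0, so that it is not needed any more.\<close>

definition update_prog :: "instr list" where
  "update_prog = [Move 12 8, Move 13 3, Move 10 0,
     Loop 10 [Dec 13, Measure 13 16, Move 17 5, Move 11 0,
       Loop 11 [Dec 12, Dec 17,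
         Branch 16 [Load 15 17, Branch 15 [Load 19 12, Branch 19 [Const 18 0] [Const 18 1], Store 12 18] []] [],
         Dec 11],
       Dec 10]]"

text \<open>The qubits in use are the \<open>w\<close> wires, the \<open>n\<close> qubits of z, the
  control and the \<open>m + 1\<close> ancillas of the zero test, hence \<open>w + n + m + 2\<close>
  in all.\<close>

definition reset_prog :: "instr list" where
  "reset_prog = [Move 10 3, Inc 10, Inc 10, Move 11 1, Loop 11 [Inc 10, Dec 11],
     Loop 10 [Dec 10, Measure 10 15, Branch 15 [Apply PauliX [10]] []]]"

definition round_prog :: "instr list" where
  "round_prog = had_prog @ [Apply PauliX [3], Apply Hadamard [3]] @
     query_prog @ [Apply CNot [3, 6]] @ query_prog @ zero_prog @ query_prog @ had_prog @
     [Move 10 0, Loop 10 [Inc 5, Dec 10]] @ update_prog @ reset_prog"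

text \<open>Without multiplication, \<open>40 + n * n\<close> and the diagonal addresses, which are
  \<open>n + 1\<close> apart, are obtained by counting. The other entries are 0 in the initial
  memory.\<close>

definition setup_prog :: "instr list" where
  "setup_prog = [Move 3 2, Const 8 40, Const 12 40, Const 15 1, Move 10 0,
     Loop 10 [Inc 3, Store 12 15, Inc 12, Move 11 0, Loop 11 [Inc 12, Inc 8, Dec 11], Dec 10]]"

text \<open>Register 0 still holds \<open>n\<close> at the end, so setting register 1 to 40 makes
  the stored matrix the output.\<close>

definition simon_prog :: "instr list" where
  "simon_prog = setup_prog @ [Const 5 40, Move 6 2, Move 7 0] @
     [Loop 7 (round_prog @ [Inc 6, Dec 7]), Const 1 40]"

lemma index_eq_iff:
  fixes i i' l l' n :: nat
  assumes "l < n" "l' < n"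
  shows "i * n + l = i' * n + l' \<longleftrightarrow> i = i' \<and> l = l'"
proof
  assume eq: "i * n + l = i' * n + l'"
  have "(i * n + l) div n = i" "(i' * n + l') div n = i'" "(i * n + l) mod n = l" "(i' * n + l') mod n = l'"
    using assms by auto
  then show "i = i' \<and> l = l'" using eq by metis
qed simp

section \<open>Correctness and running time of the matrix update, the reset and the set-up\<close>

context machine
begin

lemma wp_block:
  assumes "wp A T1 R \<sigma> \<psi>" and "T1 + T2 \<le> T" and "\<And>\<sigma> \<psi>. R \<sigma> \<psi> \<Longrightarrow> wp B T2 Q \<sigma> \<psi>"
  shows "wp (A @ B) T Q \<sigma> \<psi>"
  by (rule wp_mono[OF wp_append[OF wp_mono[OF assms(1) order_refl assms(3)]] assms(2)])

end

context layout
begin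

text \<open>The outcomes are not kept: each row is updated as soon as its bit is measured. A basis
  state that survives all measurements agrees with all outcomes, so any of them may stand for y in
  the postcondition.\<close>

lemma wp_update_prog:
  assumes env: "env \<sigma>0" and \<sigma>5: "\<sigma>0 5 = 40 + Suc j * n" and j: "j < n"
    and fin: "finite A" and good: "good A \<psi>0" and B: "stored n \<sigma>0 B"
    and low: "\<And>s i. \<psi>0 s \<noteq> 0 \<Longrightarrow> i < j \<Longrightarrow> w + i \<notin> s"
  shows "wp update_prog (n * (11 * n + 7) + 4)
    (\<lambda>\<sigma> \<psi>. (\<forall>r<10. \<sigma> r = \<sigma>0 r) \<and> good A \<psi> \<and>
      (\<forall>s. \<psi> s \<noteq> 0 \<longrightarrow> \<psi>0 s \<noteq> 0 \<and> stored n \<sigma> (\<lambda>i l. B i l \<noteq> (w + i \<in> s \<and> B j l)))) \<sigma>0 \<psi>0"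
proof -
  \<comment> \<open>\<open>P\<close> marks the positions already updated; rows and columns are
    processed from the last one down.\<close>
  define upd where "upd P s = (\<lambda>i l. B i l \<noteq> (P i l \<and> w + i \<in> s \<and> B j l))" for P :: "nat \<Rightarrow> nat \<Rightarrow> bool" and s
  define ok where "ok P \<sigma> \<psi> \<longleftrightarrow> (\<forall>r<10. \<sigma> r = \<sigma>0 r) \<and> good A \<psi> \<and>
      (\<forall>s. \<psi> s \<noteq> 0 \<longrightarrow> \<psi>0 s \<noteq> 0 \<and> stored n \<sigma> (upd P s))" for P \<sigma> \<psi>
  define outer where "outer k = (\<lambda>i (l::nat). k \<le> i)" for k :: nat
  define inner where "inner k l' = (\<lambda>i l. k < i \<or> i = k \<and> l' \<le> l)" for k l' :: nat
  have ok_upd: "ok P (\<sigma>(r := v)) \<psi> \<longleftrightarrow> ok P \<sigma> \<psi>" if "10 \<le> r" "r < 20" for P \<sigma> \<psi> r v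
    using that by (auto simp: ok_def stored_def)
  have s0: "\<sigma>0 0 = n" "\<sigma>0 2 = w" "\<sigma>0 3 = w + n" "\<sigma>0 8 = 40 + n * n" using env by (auto simp: env_def)
  have ok_cong: "ok P \<sigma>' \<psi>" if "ok P \<sigma> \<psi>" "\<And>r. r < 10 \<or> 40 \<le> r \<Longrightarrow> \<sigma>' r = \<sigma> r" for P \<sigma> \<sigma>' \<psi>
    using that by (simp add: ok_def stored_def)
  have reg: "\<sigma> 0 = n" "\<sigma> 5 = 40 + Suc j * n" if "ok P \<sigma> \<psi>" for P \<sigma> \<psi>
    using that s0 \<sigma>5 by (auto simp: ok_def)
  have outer_inner: "stored n \<sigma> (upd (outer (Suc k)) s) \<longleftrightarrow> stored n \<sigma> (upd (inner k n) s)" for \<sigma> k s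
    by (auto simp: stored_def upd_def outer_def inner_def Suc_le_eq)
  have inner_outer: "inner k 0 = outer k" for k
    by (auto simp: outer_def inner_def fun_eq_iff)
  have start: "ok (outer n) \<sigma>0 \<psi>0"
    using good B by (auto simp: ok_def outer_def upd_def stored_def)
  \<comment> \<open>A measurement makes its qubit constant on the surviving support; register 16
    then holds the bit that controls the row update.\<close>
  have meas: "ok P (\<sigma>(16 := of_bool b)) (collapse q b \<psi>) \<and>
      (\<forall>s. collapse q b \<psi> s \<noteq> 0 \<longrightarrow> (of_bool b \<noteq> (0::nat)) = (q \<in> s))"
    if i: "ok P \<sigma> \<psi>" and b: "b \<in> set_pmf (bernoulli_pmf (outcome_prob q True \<psi>))" for P \<sigma> \<psi> b q
  proof -
    have g: "good A \<psi>" using i by (simp add: ok_def)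
    note coll = good_collapse[OF fin g b]
    have "ok P \<sigma> (collapse q b \<psi>)"
      using i coll(1) unfolding ok_def coll(2) by blast
    moreover have "(of_bool b \<noteq> (0::nat)) = b" by simp
    ultimately show ?thesis
      by (simp add: ok_upd coll(2) del: set_pmf_bernoulli)
  qed
  define nxt where "nxt k l \<sigma> = (if \<sigma> 16 \<noteq> 0 \<and> \<sigma> (40 + j * n + l) \<noteq> 0
      then \<sigma>(40 + k * n + l := if \<sigma> (40 + k * n + l) \<noteq> 0 then 0 else 1) else \<sigma>)" for k l and \<sigma> :: "nat \<Rightarrow> nat"
  have body: "ok (inner k l) (nxt k l \<sigma>) \<psi>"
    if i: "ok (inner k (Suc l)) \<sigma> \<psi>" and y: "\<forall>s. \<psi> s \<noteq> 0 \<longrightarrow> (\<sigma> 16 \<noteq> 0) = (w + k \<in> s)"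
      and k: "k < n" and l: "l < n" for k l \<sigma> \<psi>
  proof -
    let ?\<sigma> = "if \<sigma> 16 \<noteq> 0 \<and> \<sigma> (40 + j * n + l) \<noteq> 0
      then \<sigma>(40 + k * n + l := if \<sigma> (40 + k * n + l) \<noteq> 0 then 0 else 1) else \<sigma>"
    have "stored n ?\<sigma> (upd (inner k l) s)" if s: "\<psi> s \<noteq> 0" for s
    proof -
      have st: "(\<sigma> (40 + i * n + l') \<noteq> 0) = upd (inner k (Suc l)) s i l'" if "i < n" "l' < n" for i l'
        using i s that by (auto simp: ok_def stored_def)
      have \<psi>0: "\<psi>0 s \<noteq> 0" using i s by (auto simp: ok_def)
      have y16: "(\<sigma> 16 \<noteq> 0) = (w + k \<in> s)" using y s by blast
      \<comment> \<open>For \<open>k = j\<close> the entry is its own pivot, and it is read before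
        it is overwritten.\<close>
      have pivot: "(\<sigma> (40 + j * n + l) \<noteq> 0) = B j l" if "w + k \<in> s"
      proof -
        have "j \<le> k" using low[OF \<psi>0, of k] that by (meson not_le)
        then show ?thesis using st[OF j l] by (auto simp: upd_def inner_def)
      qed
      show ?thesis
        unfolding stored_def
      proof (intro allI impI)
        fix i l' assume il: "i < n" "l' < n"
        show "(?\<sigma> (40 + i * n + l') \<noteq> 0) = upd (inner k l) s i l'"
        proof (cases "i = k \<and> l' = l")
          case True
          have "(\<sigma> (40 + k * n + l) \<noteq> 0) = B k l" using st[OF k l] by (auto simp: upd_def inner_def)
          then show ?thesis using True y16 pivot by (auto simp: upd_def inner_def)
        next
          case False
          then have "40 + i * n + l' \<noteq> 40 + k * n + l"
            using index_eq_iff[OF il(2) l, of i k] by simp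
          then have "?\<sigma> (40 + i * n + l') = \<sigma> (40 + i * n + l')" by simp
          moreover have "upd (inner k (Suc l)) s i l' = upd (inner k l) s i l'"
            using False by (auto simp: upd_def inner_def)
          ultimately show ?thesis using st[OF il] by simp
        qed
      qed
    qed
    then show ?thesis using i unfolding nxt_def by (auto simp: ok_def)
  qed
  show ?thesis
    unfolding update_prog_def
    apply (rule wp_Move, simp)
    apply (rule wp_Move, simp)
    apply (rule wp_Move, simp)
    apply (rule wp_Loop_upto[where b = "11 * n + 6" and T' = 0 and I = "\<lambda>k \<sigma> \<psi>. ok (outer k) \<sigma> \<psi> \<and>
        k \<le> n \<and> \<sigma> 12 = 40 + k * n \<and> \<sigma> 13 = w + k"])
    subgoal for k \<sigma> \<psi>
      apply (elim conjE)
      apply (rule wp_Dec, simp)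
      apply (rule wp_Measure, simp)
      subgoal for b
        apply (rule wp_Move, simp)
        apply (rule wp_Move, simp)
        apply (rule wp_Loop_upto[where b = 10 and T' = 1 and I = "\<lambda>l \<sigma> \<psi>. ok (inner k l) \<sigma> \<psi> \<and> l \<le> n \<and>
          \<sigma> 10 = Suc k \<and> \<sigma> 12 = 40 + k * n + l \<and> \<sigma> 13 = w + k \<and> \<sigma> 17 = 40 + j * n + l \<and>
          (\<forall>s. \<psi> s \<noteq> 0 \<longrightarrow> (\<sigma> 16 \<noteq> 0) = (w + k \<in> s))"])
        subgoal for l \<sigma>' \<psi>'
          apply (elim conjE)
          apply (frule (1) body, simp, simp)
          apply (rule wp_Dec, simp)
          apply (rule wp_Dec, simp, simp)
          apply (rule wp_Branch, simp)
          subgoal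
            apply simp
            apply (rule wp_Load, simp, simp)
            apply (rule wp_Branch, simp)
            subgoal
              apply simp
              apply (rule wp_Load, simp, simp)
              apply (rule wp_Branch, simp)
              subgoal
                apply simp
                apply (rule wp_Const, simp)
                apply (rule wp_Store, simp, simp)
                apply (rule wp_Dec, simp, simp)
                apply (rule wp_Nil)
                by (intro conjI; ((erule ok_cong, auto simp: nxt_def add.assoc) | simp))
              subgoal
                apply simp
                apply (rule wp_Const, simp)
                apply (rule wp_Store, simp, simp)
                apply (rule wp_Dec, simp, simp)
                apply (rule wp_Nil)
                by (intro conjI; ((erule ok_cong, auto simp: nxt_def add.assoc) | simp))
              done
            subgoal
              apply simp
              apply (rule wp_Dec, simp, simp)
              apply (rule wp_Nil)
              by (intro conjI; ((erule ok_cong, auto simp: nxt_def add.assoc) | simp))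
            done
          subgoal
            apply simp
            apply (rule wp_Dec, simp, simp)
            apply (rule wp_Nil)
            by (intro conjI; ((erule ok_cong, auto simp: nxt_def add.assoc) | simp))
          done
        subgoal
          using meas[of "outer (Suc k)" \<sigma> \<psi> b "w + k"] reg[of "outer (Suc k)" \<sigma> \<psi>]
          by (simp add: ok_upd) (simp add: ok_def outer_inner)
        subgoal using reg[of "outer (Suc k)" \<sigma> \<psi>] by simp
        subgoal for \<sigma>' \<psi>'
          apply (elim conjE)
          apply (rule wp_Dec, simp)
          apply (rule wp_Nil)
          by (simp add: ok_upd inner_outer)
        done
      done
    subgoal using start by (simp add: s0 ok_upd)
    subgoal by (simp add: s0)
    subgoal by (rule wp_Nil) (auto simp: ok_def upd_def outer_def)
    done
qed

text \<open>Measuring a qubit and flipping it on outcome 1 leaves it 0 in every surviving basis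
  state; after all qubits only the empty set remains, with some phase.\<close>

lemma wp_reset_prog:
  assumes env: "env \<sigma>0" and good: "good {..<w + n + m + 2} \<psi>0"
  shows "wp reset_prog (5 * w + 5 * n + 9 * m + 20)
    (\<lambda>\<sigma> \<psi>. frame \<sigma>0 \<sigma> \<and> good {..<w + n + m + 2} \<psi> \<and> (\<forall>s. \<psi> s \<noteq> 0 \<longrightarrow> s = {})) \<sigma>0 \<psi>0"
proof -
  let ?A = "{..<w + n + m + 2}"
  define ok where "ok k \<psi> \<longleftrightarrow> good ?A \<psi> \<and> k \<le> w + n + m + 2 \<and> (\<forall>s q. \<psi> s \<noteq> 0 \<longrightarrow> k \<le> q \<longrightarrow> q \<notin> s)" for k \<psi>
  have s0: "\<sigma>0 1 = m" "\<sigma>0 3 = w + n" using env by (auto simp: env_def)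
  have step: "ok k (if b then collapse k b \<psi> \<circ> tog {k} else collapse k b \<psi>)"
    if ok: "ok (Suc k) \<psi>" and b: "b \<in> set_pmf (bernoulli_pmf (outcome_prob k True \<psi>))" for k b \<psi>
  proof -
    have g: "good ?A \<psi>" and k: "k < w + n + m + 2" using ok by (auto simp: ok_def)
    have high: "q \<notin> s" if "\<psi> s \<noteq> 0" "k < q" for s q using ok that by (auto simp: ok_def)
    note coll = good_collapse[OF _ g b]
    have "q \<notin> s" if s: "(if b then collapse k b \<psi> \<circ> tog {k} else collapse k b \<psi>) s \<noteq> 0" and "k \<le> q" for s q
    proof (cases "q = k")
      case True
      then show ?thesis using s coll(2) by (cases b) auto
    next
      case False
      with \<open>k \<le> q\<close> have q: "k < q" by simp
      show ?thesis
      proof (cases b)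
        case True
        then have "\<psi> (tog {k} s) \<noteq> 0" using s coll(2) by auto
        then have "q \<notin> tog {k} s" using q by (rule high)
        then show ?thesis using q by simp
      next
        case False
        then show ?thesis using s coll(2) q high by auto
      qed
    qed
    moreover have "good ?A (if b then collapse k b \<psi> \<circ> tog {k} else collapse k b \<psi>)"
      using coll(1) k by (auto intro!: good_comp_tog_const)
    ultimately show ?thesis using k unfolding ok_def by simp
  qed
  show ?thesis
    unfolding reset_prog_def
    apply (rule wp_Move, simp)
    apply (rule wp_Inc, simp)
    apply (rule wp_Inc, simp)
    apply (rule wp_Move, simp)
    apply (rule wp_Loop_upto[where b = 2 and T' = "(w + n + m + 2) * 5 + 1" and
        I = "\<lambda>k \<sigma> \<psi>. frame \<sigma>0 \<sigma> \<and> \<psi> = \<psi>0 \<and> \<sigma> 10 + k = w + n + m + 2"])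
    subgoal for k \<sigma> \<psi>
      apply (rule wp_Inc, simp)
      apply (rule wp_Dec, simp)
      apply (rule wp_Nil)
      by simp
    subgoal using s0 by simp
    subgoal using s0 by simp
    subgoal for \<sigma> \<psi>
      apply (rule wp_Loop_upto[where b = 4 and T' = 0 and I = "\<lambda>k \<sigma> \<psi>. frame \<sigma>0 \<sigma> \<and> ok k \<psi>"])
      subgoal for k \<sigma>' \<psi>'
        apply (elim conjE)
        apply (rule wp_Dec, simp)
        apply (rule wp_Measure, simp)
        subgoal for b
          apply (rule wp_Branch, simp)
          subgoal
            apply (simp only: append.simps)
            apply (rule wp_PauliX, simp)
            apply (rule wp_Nil)
            using step[of k \<psi>' b] by (cases b) (simp_all del: set_pmf_bernoulli)
          subgoal
            apply (simp only: append.simps)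
            apply (rule wp_Nil)
            using step[of k \<psi>' b] by (cases b) (simp_all del: set_pmf_bernoulli)
          done
        done
      subgoal using good good_subset[OF good] by (fastforce simp: ok_def)
      subgoal by simp
      subgoal by (rule wp_Nil) (auto simp: ok_def)
      done
    done
qed

lemma wp_setup_prog:
  assumes "\<sigma>0 = (\<lambda>_. 0)(0 := n, 1 := m, 2 := w)"
  shows "wp setup_prog (n * (4 * n + 7) + 6)
    (\<lambda>\<sigma> \<psi>. env \<sigma> \<and> stored n \<sigma> (\<lambda>i l. i = l) \<and> \<psi> = \<psi>0) \<sigma>0 \<psi>0"
proof -
  define ok where "ok i \<sigma> \<longleftrightarrow> \<sigma> 0 = n \<and> \<sigma> 1 = m \<and> \<sigma> 2 = w \<and>
      (\<forall>r\<ge>40. (\<sigma> r \<noteq> 0) = (\<exists>k<i. r = 40 + k * n + k))" for i :: nat and \<sigma> :: "nat \<Rightarrow> nat"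
  have ok_upd: "ok i (\<sigma>(r := v)) \<longleftrightarrow> ok i \<sigma>" if "3 \<le> r" "r < 40" for i \<sigma> r v
    using that by (auto simp: ok_def)
  have reg: "\<sigma> 0 = n" if "ok i \<sigma>" for i \<sigma>
    using that by (simp add: ok_def)
  have store: "ok (Suc i) (\<sigma>(40 + i * n + i := 1))" if "ok i \<sigma>" for i \<sigma>
    using that by (auto simp: ok_def less_Suc_eq)
  have fin: "stored n \<sigma> (\<lambda>i l. i = l)" if "ok n \<sigma>" for \<sigma>
    unfolding stored_def
  proof (intro allI impI)
    fix i l assume il: "i < n" "l < n"
    have "(\<sigma> (40 + i * n + l) \<noteq> 0) = (\<exists>k<n. i * n + l = k * n + k)" using that by (simp add: ok_def)
    also have "\<dots> = (i = l)" using il index_eq_iff[OF il(2)] by metis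
    finally show "(\<sigma> (40 + i * n + l) \<noteq> 0) = (i = l)" .
  qed
  show ?thesis
    unfolding setup_prog_def
    apply (rule wp_Move, simp)
    apply (rule wp_Const, simp)
    apply (rule wp_Const, simp)
    apply (rule wp_Const, simp)
    apply (rule wp_Move, simp)
    apply (rule wp_Loop_upto[where b = "4 * n + 6" and T' = 0 and I = "\<lambda>k \<sigma> \<psi>. \<psi> = \<psi>0 \<and>
        (\<exists>i. i + k = n \<and> ok i \<sigma> \<and> \<sigma> 3 = w + i \<and> \<sigma> 8 = 40 + i * n \<and> \<sigma> 12 = 40 + i * n + i \<and> \<sigma> 15 = 1)"])
    subgoal for k \<sigma> \<psi>
      apply (elim conjE exE)
      subgoal for i
        apply (rule wp_Inc, simp)
        apply (rule wp_Store, simp)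
        apply (rule wp_Inc, simp)
        apply (rule wp_Move, simp)
        apply (rule wp_Loop_upto[where b = 3 and T' = 1 and I = "\<lambda>k' \<sigma> \<psi>. \<psi> = \<psi>0 \<and> ok (Suc i) \<sigma> \<and>
          \<sigma> 10 = Suc k \<and> \<sigma> 3 = w + Suc i \<and> \<sigma> 15 = 1 \<and>
          (\<exists>l. l + k' = n \<and> \<sigma> 8 = 40 + i * n + l \<and> \<sigma> 12 = 40 + i * n + l + Suc i)"])
        subgoal
          apply (rule wp_Inc, simp)
          apply (rule wp_Inc, simp)
          apply (rule wp_Dec, simp)
          apply (rule wp_Nil)
          by (auto simp: ok_upd)
        subgoal using store[of i "\<sigma>(11 := n, 3 := Suc (w + i))"] reg[of i \<sigma>] by (simp add: ok_upd fun_upd_twist)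
        subgoal using reg[of i \<sigma>] by simp
        subgoal for \<sigma>' \<psi>'
          apply (elim conjE exE)
          apply (rule wp_Dec, simp)
          apply (rule wp_Nil)
          by (auto simp: ok_upd intro!: exI[of _ "Suc i"])
        done
      done
    subgoal by (simp add: assms ok_def)
    subgoal by (simp add: assms)
    subgoal by (rule wp_Nil) (auto simp: env_def fin, auto simp: ok_def)
    done
qed

end

section \<open>Composition of a round and of the whole algorithm\<close>

locale simon_machine = layout w C n m + simon_round n m w H f
  for w C n m H f +
  assumes circuit: "\<And>\<psi>. (\<And>s. \<psi> s \<noteq> 0 \<Longrightarrow> s \<inter> {n + m..<w} = {}) \<Longrightarrow> run_circuit C \<psi> = \<psi> \<circ> query n m f"
begin

definition query_time :: nat where
  "query_time = 2 * (n * (7 * n + 8) + 4) + circuit_size w C + 1"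

lemma wp_query_prog:
  assumes env: "env \<sigma>0" and B: "stored n \<sigma>0 B"
    and supp: "\<And>s. \<psi>0 s \<noteq> 0 \<Longrightarrow> s \<inter> {n + m..<w} = {}"
  shows "wp query_prog query_time (\<lambda>\<sigma> \<psi>. frame \<sigma>0 \<sigma> \<and> \<psi> = \<psi>0 \<circ> evaluate B) \<sigma>0 \<psi>0"
proof -
  let ?L = "lin w (positions n B)" and ?T = "n * (7 * n + 8) + 4"
  have "s \<inter> {n + m..<w} = {}" if "(\<psi>0 \<circ> ?L) s \<noteq> 0" for s
  proof -
    have "?L s \<inter> {n + m..<w} = {}" using that supp by simp
    moreover have "q \<in> ?L s \<longleftrightarrow> q \<in> s" if "n \<le> q" for q
    proof -
      have "{i. (i, q) \<in> positions n B \<and> w + i \<in> s} = {}" using that by (auto simp: positions_def)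
      then have "card {i. (i, q) \<in> positions n B \<and> w + i \<in> s} = 0" by (simp only: card.empty)
      then show ?thesis by (simp add: lin_def)
    qed
    ultimately show ?thesis unfolding disjoint_iff by (metis add_leD1 atLeastLessThan_iff)
  qed
  then have run: "run_circuit C (\<psi>0 \<circ> ?L) = \<psi>0 \<circ> ?L \<circ> query n m f" by (rule circuit)
  have eval: "\<psi>0 \<circ> ?L \<circ> query n m f \<circ> ?L = \<psi>0 \<circ> evaluate B"
    by (rule ext) (simp add: lin_query_lin)
  show ?thesis
    unfolding query_prog_def
    apply (rule wp_block[OF wp_lin_prog[OF env B], where ?T2.0 = "circuit_size w C + 1 + ?T"])
    subgoal by (simp add: query_time_def)
    subgoal for \<sigma> \<psi>
      apply (simp only: append.simps)
      apply (rule wp_Subroutine, simp)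
      apply (rule wp_mono[OF wp_lin_prog[of _ B]])
      subgoal using env frame_env by blast
      subgoal using B frame_stored by blast
      subgoal by simp
      subgoal using frame_trans by (auto simp: run eval)
      done
    done
qed

text \<open>It contains no work qubit of the subroutine and no ancilla, so a state supported here
  meets the support conditions of both \<open>wp_query_prog\<close> and
  \<open>wp_zero_prog\<close>.\<close>

definition workspace :: "nat set" where
  "workspace = {..<n + m} \<union> {w..w + n}"

lemma good_evaluate: "good workspace \<psi> \<Longrightarrow> good workspace (\<psi> \<circ> evaluate B)"
proof (rule good_comp)
  show "evaluate B s \<subseteq> workspace" if "s \<subseteq> workspace" for s
  proof -
    have "{n + k | k. k < m \<and> val B s ! k} \<subseteq> workspace" by (auto simp: workspace_def)
    then show ?thesis using that by (auto simp only: evaluate_def mem_tog subset_iff)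
  qed
qed simp_all

lemma good_zero_test: "good workspace \<psi> \<Longrightarrow> good workspace (\<psi> \<circ> zero_test n m (w + n))"
  unfolding zero_test_def [abs_def] using nm
  by (intro good_comp_tog) (auto simp: workspace_def)

lemma good_workspace_cnot: "good workspace \<psi> \<Longrightarrow> j < n \<Longrightarrow> good workspace (\<psi> \<circ> cnot (w + n) (w + j))"
  by (rule good_comp_cnot) (auto simp: workspace_def)

lemma workspace_clean: "good workspace \<psi> \<Longrightarrow> \<psi> s \<noteq> 0 \<Longrightarrow> s \<inter> {n + m..<w} = {}"
  by (drule good_subset) (auto simp: workspace_def)

abbreviation qubits :: "nat set" where
  "qubits \<equiv> {..<w + n + m + 2}"

definition vacuum :: "qstate \<Rightarrow> bool" where
  "vacuum \<psi> \<longleftrightarrow> good qubits \<psi> \<and> (\<forall>s. \<psi> s \<noteq> 0 \<longrightarrow> s = {})"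

definition round_time :: nat where
  "round_time = 2 * (4 * n + 3) + 3 * query_time + (16 * m + 12) + (n * (11 * n + 7) + 4) +
     (5 * w + 5 * n + 9 * m + 20) + 3 * n + 10"

lemma wp_round_quantum:
  assumes env: "env \<sigma>0" and \<sigma>6: "\<sigma>0 6 = w + j" and j: "j < n" and B: "stored n \<sigma>0 B"
    and vac: "vacuum \<psi>0"
    and cont: "\<And>\<sigma>. frame \<sigma>0 \<sigma> \<Longrightarrow> wp A T Q \<sigma> (round_state B j \<psi>0)"
  shows "wp (had_prog @ [Apply PauliX [3], Apply Hadamard [3]] @
     query_prog @ [Apply CNot [3, 6]] @ query_prog @ zero_prog @ query_prog @ had_prog @ A)
     (2 * (4 * n + 3) + 3 * query_time + (16 * m + 12) + 3 + T) Q \<sigma>0 \<psi>0"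
proof -
  let ?E = "evaluate B"
  define \<psi>1 where "\<psi>1 = prepared w n \<psi>0"
  define \<psi>2 where "\<psi>2 = \<psi>1 \<circ> ?E \<circ> cnot (w + n) (w + j)"
  define \<psi>3 where "\<psi>3 = \<psi>2 \<circ> ?E \<circ> zero_test n m (w + n)"
  have g1: "good workspace \<psi>1"
    unfolding \<psi>1_def
    by (rule good_mono[OF _ _ prepared(1)[of qubits]]) (use vac in \<open>auto simp: vacuum_def workspace_def\<close>)
  have g2: "good workspace \<psi>2"
    unfolding \<psi>2_def using g1 j by (intro good_workspace_cnot good_evaluate)
  have g3: "good workspace \<psi>3"
    unfolding \<psi>3_def using g2 by (intro good_zero_test good_evaluate)
  have g2': "s \<subseteq> {..<w + n + 1}" if "(\<psi>2 \<circ> ?E) s \<noteq> 0" for s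
    using good_subset[OF good_evaluate[OF g2] that] nm by (auto simp: workspace_def)
  have final: "hads w n (\<psi>3 \<circ> ?E) = round_state B j \<psi>0"
    unfolding round_state_def \<psi>3_def \<psi>2_def \<psi>1_def
    by (intro arg_cong[of _ _ "hads w n"] ext) (simp add: round_map_def)
  have step: "env \<sigma> \<and> stored n \<sigma> B \<and> \<sigma> 3 = w + n \<and> \<sigma> 6 = w + j" if "frame \<sigma>0 \<sigma>" for \<sigma>
    using that env B \<sigma>6 frame_env frame_stored frame_low[OF that, of 6] by (auto simp: env_def)
  have had: "wp (had_prog @ A') (4 * n + 3 + T') Q \<sigma> \<psi>"
    if "frame \<sigma>0 \<sigma>" "\<And>\<sigma>. frame \<sigma>0 \<sigma> \<Longrightarrow> wp A' T' Q \<sigma> (hads w n \<psi>)" for \<sigma> \<psi> A' T'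
    by (rule wp_block[OF wp_had_prog order_refl]) (use that step frame_trans in blast)+
  have query: "wp (query_prog @ A') (query_time + T') Q \<sigma> \<psi>"
    if "good workspace \<psi>" "frame \<sigma>0 \<sigma>" "\<And>\<sigma>. frame \<sigma>0 \<sigma> \<Longrightarrow> wp A' T' Q \<sigma> (\<psi> \<circ> ?E)" for \<sigma> \<psi> A' T'
    by (rule wp_block[OF wp_query_prog[of _ B] order_refl])
      (use that step frame_trans workspace_clean in blast)+
  have zero: "wp (zero_prog @ A') (16 * m + 12 + T') Q \<sigma> (\<psi>2 \<circ> ?E)"
    if "frame \<sigma>0 \<sigma>" "\<And>\<sigma>. frame \<sigma>0 \<sigma> \<Longrightarrow> wp A' T' Q \<sigma> (\<psi>2 \<circ> ?E \<circ> zero_test n m (w + n))" for \<sigma> A' T'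
    by (rule wp_block[OF wp_zero_prog order_refl]) (use that step frame_trans g2' in blast)+
  \<comment> \<open>The facts 1 to 7 go backwards through the program, each serving as the
    continuation of the next.\<close>
  have 1: "wp (had_prog @ A) (4 * n + 3 + T) Q \<sigma> (\<psi>3 \<circ> ?E)" if "frame \<sigma>0 \<sigma>" for \<sigma>
    by (rule had[OF that]) (simp add: final cont)
  have 2: "wp (query_prog @ had_prog @ A) (query_time + (4 * n + 3 + T)) Q \<sigma> \<psi>3" if "frame \<sigma>0 \<sigma>" for \<sigma>
    by (rule query[OF g3 that 1])
  have 3: "wp (zero_prog @ query_prog @ had_prog @ A)
      (16 * m + 12 + (query_time + (4 * n + 3 + T))) Q \<sigma> (\<psi>2 \<circ> ?E)" if "frame \<sigma>0 \<sigma>" for \<sigma>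
    by (rule zero[OF that]) (rule 2[unfolded \<psi>3_def])
  have 4: "wp (query_prog @ zero_prog @ query_prog @ had_prog @ A)
      (query_time + (16 * m + 12 + (query_time + (4 * n + 3 + T)))) Q \<sigma> \<psi>2" if "frame \<sigma>0 \<sigma>" for \<sigma>
    by (rule query[OF g2 that 3])
  have 5: "wp ([Apply CNot [3, 6]] @ query_prog @ zero_prog @ query_prog @ had_prog @ A)
      (query_time + (16 * m + 12 + (query_time + (4 * n + 3 + T))) + 1) Q \<sigma> (\<psi>1 \<circ> ?E)" if "frame \<sigma>0 \<sigma>" for \<sigma>
    unfolding append.simps
    by (rule wp_CNot) (use 4[OF that] step[OF that] j in \<open>simp_all add: \<psi>2_def algebra_simps\<close>)
  have 6: "wp (query_prog @ [Apply CNot [3, 6]] @ query_prog @ zero_prog @ query_prog @ had_prog @ A)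
      (query_time + (query_time + (16 * m + 12 + (query_time + (4 * n + 3 + T))) + 1)) Q \<sigma> \<psi>1" if "frame \<sigma>0 \<sigma>" for \<sigma>
    by (rule query[OF g1 that 5])
  have 7: "wp ([Apply PauliX [3], Apply Hadamard [3]] @ query_prog @ [Apply CNot [3, 6]] @
       query_prog @ zero_prog @ query_prog @ had_prog @ A)
      (query_time + (query_time + (16 * m + 12 + (query_time + (4 * n + 3 + T))) + 1) + 2) Q \<sigma> (hads w n \<psi>0)"
    if "frame \<sigma>0 \<sigma>" for \<sigma>
    unfolding append.simps
    apply (rule wp_PauliX, simp)
    apply (rule wp_Hadamard, simp)
    using 6[OF that] step[OF that] by (simp add: \<psi>1_def prepared_def algebra_simps)
  show ?thesis
    by (rule wp_mono[OF had[OF frame_refl 7]]) simp_all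
qed

definition reduced :: "nat \<Rightarrow> (nat \<Rightarrow> nat \<Rightarrow> bool) \<Rightarrow> bool" where
  "reduced j B \<longleftrightarrow> (\<forall>i<j. bit_row n B i \<in> H) \<and> (\<forall>h\<in>H. \<exists>I\<subseteq>{..<n}. h = comb n B I)"

lemma zero_in_H: "replicate n False \<in> H"
  using subgroup.one_closed[OF sub] by (simp add: Z2_def)

lemma reduced_0: "reduced 0 (\<lambda>i l. i = l)"
  unfolding reduced_def
proof (intro conjI ballI)
  fix h assume "h \<in> H"
  then have len: "length h = n" using subgroup.subset[OF sub] by (auto simp: Z2_def)
  have "{i. i < n \<and> h ! i \<and> i = l} = (if h ! l then {l} else {})" if "l < n" for l
    using that by auto
  then have "h = comb n (\<lambda>i l. i = l) {i. i < n \<and> h ! i}"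
    using len by (intro nth_equalityI) (auto simp: comb_def conj_assoc)
  then show "\<exists>I\<subseteq>{..<n}. h = comb n (\<lambda>i l. i = l) I" by (intro exI[of _ "{i. i < n \<and> h ! i}"]) auto
qed simp

text \<open>Rows before \<open>j\<close> are already in \<open>H\<close>, so the parity condition
  for a single index makes \<open>y i\<close> false and leaves them unchanged. The same condition
  lets every vector of \<open>H\<close> keep its coefficient set, by
  \<open>comb_update\<close>.\<close>

lemma reduced_step:
  assumes B: "reduced j B" and j: "j < n"
    and even: "\<And>I. I \<subseteq> {..<n} \<Longrightarrow> comb n B I \<in> H \<Longrightarrow> even (card {i \<in> I. y i})"
    and pivot: "bit_row n B j \<notin> H \<Longrightarrow> y j"
  shows "reduced (Suc j) (\<lambda>i l. B i l \<noteq> (y i \<and> B j l))"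
  unfolding reduced_def
proof (intro conjI allI impI ballI)
  fix i assume "i < Suc j"
  then consider "i < j" | "i = j" by linarith
  then show "bit_row n (\<lambda>i l. B i l \<noteq> (y i \<and> B j l)) i \<in> H"
  proof cases
    case 1
    then have row: "bit_row n B i \<in> H" using B by (simp add: reduced_def)
    then have "even (card {k \<in> {i}. y k})"
      using 1 j by (intro even) (auto simp: comb_singleton)
    moreover have "{k \<in> {i}. y k} = (if y i then {i} else {})" by auto
    ultimately have "\<not> y i" by (auto split: if_splits)
    then show ?thesis using row by (simp add: bit_row_def)
  next
    case 2
    show ?thesis
    proof (cases "y j")
      case True
      then show ?thesis using 2 zero_in_H by (simp add: bit_row_def map_replicate_trivial)
    next
      case False
      then show ?thesis using 2 pivot by (auto simp: bit_row_def)
    qed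
  qed
next
  fix h assume h: "h \<in> H"
  then obtain I where I: "I \<subseteq> {..<n}" "h = comb n B I" using B by (auto simp: reduced_def)
  have "finite I" using I(1) finite_subset by blast
  moreover have "even (card {i \<in> I. y i})" using even I h by blast
  ultimately have "h = comb n (\<lambda>i l. B i l \<noteq> (y i \<and> B j l)) I"
    using I(2) by (subst comb_update) simp_all
  then show "\<exists>I\<subseteq>{..<n}. h = comb n (\<lambda>i l. B i l \<noteq> (y i \<and> B j l)) I" using I(1) by blast
qed

definition round_inv :: "nat \<Rightarrow> (nat \<Rightarrow> nat) \<Rightarrow> qstate \<Rightarrow> bool" where
  "round_inv j \<sigma> \<psi> \<longleftrightarrow> env \<sigma> \<and> \<sigma> 5 = 40 + j * n \<and> vacuum \<psi> \<and> (\<exists>B. stored n \<sigma> B \<and> reduced j B)"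

lemma wp_round_prog:
  assumes inv: "round_inv j \<sigma>0 \<psi>0" and \<sigma>6: "\<sigma>0 6 = w + j" and j: "j < n"
  shows "wp round_prog round_time
    (\<lambda>\<sigma> \<psi>. round_inv (Suc j) \<sigma> \<psi> \<and> \<sigma> 6 = \<sigma>0 6 \<and> \<sigma> 7 = \<sigma>0 7) \<sigma>0 \<psi>0"
proof -
  obtain B where env: "env \<sigma>0" and \<sigma>5: "\<sigma>0 5 = 40 + j * n" and vac: "vacuum \<psi>0"
    and B: "stored n \<sigma>0 B" "reduced j B"
    using inv by (auto simp: round_inv_def)
  let ?\<psi> = "round_state B j \<psi>0"
  have good0: "good qubits \<psi>0" and vac0: "\<And>s. \<psi>0 s \<noteq> 0 \<Longrightarrow> s = {}"
    using vac by (auto simp: vacuum_def)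
  have parity: "even (card {i \<in> I. w + i \<in> s})" if "?\<psi> s \<noteq> 0" "I \<subseteq> {..<n}" "comb n B I \<in> H" for s I
    using round_state(1)[OF _ good0 vac0 j that(1)] that by simp
  have pivot: "w + j \<in> s" if "?\<psi> s \<noteq> 0" "bit_row n B j \<notin> H" for s
    using round_state(2)[OF _ good0 vac0 j that(1)] that by simp
  have low: "w + i \<notin> s" if s: "?\<psi> s \<noteq> 0" and i: "i < j" for s i
  proof
    assume "w + i \<in> s"
    then have "{k \<in> {i}. w + k \<in> s} = {i}" by auto
    moreover have "even (card {k \<in> {i}. w + k \<in> s})"
      by (rule parity[OF s]) (use i j B in \<open>auto simp: reduced_def comb_singleton\<close>)
    ultimately show False by simp
  qed
  have good: "good qubits ?\<psi>"
  proof -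
    have "good workspace (prepared w n \<psi>0)"
      by (rule good_mono[OF _ _ prepared(1)[OF _ good0 vac0]]) (auto simp: workspace_def)
    then have "good workspace (prepared w n \<psi>0 \<circ> evaluate B \<circ> cnot (w + n) (w + j) \<circ> evaluate B
        \<circ> zero_test n m (w + n) \<circ> evaluate B)"
      using j by (intro good_evaluate good_zero_test good_workspace_cnot)
    moreover have "prepared w n \<psi>0 \<circ> evaluate B \<circ> cnot (w + n) (w + j) \<circ> evaluate B
        \<circ> zero_test n m (w + n) \<circ> evaluate B = prepared w n \<psi>0 \<circ> round_map B j"
      by (rule ext) (simp add: round_map_def)
    ultimately have "good workspace (prepared w n \<psi>0 \<circ> round_map B j)" by simp
    then have "good workspace ?\<psi>"
      unfolding round_state_def by (intro good_hads) (auto simp: workspace_def)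
    then show ?thesis by (rule good_mono[rotated 2]) (use nm in \<open>auto simp: workspace_def\<close>)
  qed
  let ?T1 = "n * (11 * n + 7) + 4" and ?T2 = "5 * w + 5 * n + 9 * m + 20"
  define Q where "Q \<sigma> \<psi> \<longleftrightarrow> round_inv (Suc j) \<sigma> \<psi> \<and> \<sigma> 6 = \<sigma>0 6 \<and> \<sigma> 7 = \<sigma>0 7" for \<sigma> \<psi>
  define inv1 where "inv1 \<sigma> \<longleftrightarrow> env \<sigma> \<and> \<sigma> 5 = 40 + Suc j * n \<and> \<sigma> 6 = \<sigma>0 6 \<and> \<sigma> 7 = \<sigma>0 7" for \<sigma>
  have reset: "wp reset_prog ?T2 Q \<sigma> \<psi>"
    if \<sigma>: "inv1 \<sigma>" and g: "good qubits \<psi>"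
      and st: "\<And>s. \<psi> s \<noteq> 0 \<Longrightarrow> ?\<psi> s \<noteq> 0 \<and> stored n \<sigma> (\<lambda>i l. B i l \<noteq> (w + i \<in> s \<and> B j l))" for \<sigma> \<psi>
  proof -
    \<comment> \<open>Normalization provides a surviving basis state; its bits serve as the measured
      vector y.\<close>
    obtain s where "\<psi> s \<noteq> 0" using good_nonzero[OF g] by blast
    then have s: "?\<psi> s \<noteq> 0" and stored: "stored n \<sigma> (\<lambda>i l. B i l \<noteq> (w + i \<in> s \<and> B j l))"
      using st by blast+
    have red: "reduced (Suc j) (\<lambda>i l. B i l \<noteq> (w + i \<in> s \<and> B j l))"
      by (rule reduced_step[OF B(2) j]) (use s parity pivot in blast)+
    have env: "env \<sigma>" using \<sigma> by (simp add: inv1_def)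
    show ?thesis
    proof (rule wp_mono[OF wp_reset_prog[OF env g] order_refl])
      fix \<sigma>' \<psi>'
      assume *: "frame \<sigma> \<sigma>' \<and> good qubits \<psi>' \<and> (\<forall>s. \<psi>' s \<noteq> 0 \<longrightarrow> s = {})"
      then have fr: "frame \<sigma> \<sigma>'" by simp
      have "stored n \<sigma>' (\<lambda>i l. B i l \<noteq> (w + i \<in> s \<and> B j l))"
        using stored frame_stored[OF fr] by blast
      then show "Q \<sigma>' \<psi>'"
        using * \<sigma> red frame_env[OF fr] frame_low[OF fr]
        by (auto simp: Q_def round_inv_def inv1_def vacuum_def)
    qed
  qed
  have update: "wp (update_prog @ reset_prog) (?T1 + ?T2) Q \<sigma> ?\<psi>"
    if \<sigma>: "inv1 \<sigma>" and st: "stored n \<sigma> B" for \<sigma>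
  proof (rule wp_block[OF wp_update_prog[where j = j and A = qubits] order_refl])
    fix \<sigma>' \<psi>'
    assume *: "(\<forall>r<10. \<sigma>' r = \<sigma> r) \<and> good qubits \<psi>' \<and>
      (\<forall>s. \<psi>' s \<noteq> 0 \<longrightarrow> ?\<psi> s \<noteq> 0 \<and> stored n \<sigma>' (\<lambda>i l. B i l \<noteq> (w + i \<in> s \<and> B j l)))"
    then have "inv1 \<sigma>'" using \<sigma> by (simp add: inv1_def env_def)
    then show "wp reset_prog ?T2 Q \<sigma>' \<psi>'" using * by (intro reset) auto
  qed (use \<sigma> st j good low in \<open>auto simp: inv1_def\<close>)
  have advance: "wp ([Move 10 0, Loop 10 [Inc 5, Dec 10]] @ update_prog @ reset_prog)
      (3 * n + 2 + (?T1 + ?T2)) Q \<sigma> ?\<psi>" if fr: "frame \<sigma>0 \<sigma>" for \<sigma>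
  proof -
    have \<sigma>: "env \<sigma>" "stored n \<sigma> B" "\<sigma> 5 = 40 + j * n" "\<sigma> 6 = \<sigma>0 6" "\<sigma> 7 = \<sigma>0 7"
      using env B \<sigma>5 frame_env[OF fr] frame_stored[OF fr] frame_low[OF fr] by auto
    show ?thesis
      unfolding append.simps
      apply (rule wp_Move, simp)
      apply (rule wp_Loop_upto[where b = 2 and T' = "?T1 + ?T2" and
          I = "\<lambda>k \<sigma> \<psi>. env \<sigma> \<and> stored n \<sigma> B \<and> \<sigma> 5 + k = 40 + Suc j * n \<and> \<sigma> 6 = \<sigma>0 6 \<and> \<sigma> 7 = \<sigma>0 7 \<and> \<psi> = ?\<psi>"])
      subgoal
        apply (rule wp_Inc, simp)
        apply (rule wp_Dec, simp)
        apply (rule wp_Nil)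
        by (auto simp: env_def stored_def)
      subgoal using \<sigma> by (auto simp: env_def stored_def)
      subgoal using \<sigma> by (simp add: env_def)
      subgoal using update by (simp add: inv1_def)
      done
  qed
  have "wp round_prog (2 * (4 * n + 3) + 3 * query_time + (16 * m + 12) + 3 + (3 * n + 2 + (?T1 + ?T2))) Q \<sigma>0 \<psi>0"
    unfolding round_prog_def by (rule wp_round_quantum[OF env \<sigma>6 j B(1) vac advance])
  then have "wp round_prog round_time Q \<sigma>0 \<psi>0"
    by (rule wp_mono) (simp_all add: round_time_def)
  then show ?thesis unfolding Q_def .
qed

definition total_time :: nat where
  "total_time = n * (4 * n + 7) + 6 + 3 + (n * (round_time + 3) + 2)"

lemma wp_simon_prog:
  assumes "\<sigma>0 = (\<lambda>_. 0)(0 := n, 1 := m, 2 := w)"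
  shows "wp simon_prog total_time (\<lambda>\<sigma> \<psi>. generate (Z2 n) (output_set n \<sigma>) = H) \<sigma>0 (ket {})"
proof -
  have vac: "vacuum (ket {})"
    by (simp add: vacuum_def good_ket) (simp add: ket_def)
  have finish: "generate (Z2 n) (output_set n (\<sigma>(Suc 0 := 40))) = H" if inv: "round_inv n \<sigma> \<psi>" for \<sigma> \<psi>
  proof -
    obtain B where \<sigma>0: "\<sigma> 0 = n" and B: "stored n \<sigma> B" "reduced n B"
      using inv by (auto simp: round_inv_def env_def)
    define \<sigma>' where "\<sigma>' = \<sigma>(Suc 0 := 40)"
    have row: "map (\<lambda>l. \<sigma>' (\<sigma>' 1 + i * n + l) \<noteq> 0) [0..<n] = bit_row n B i" if "i < n" for i
      using B(1) that by (simp add: bit_row_def stored_def \<sigma>'_def)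
    have out: "output_set n \<sigma>' = {map (\<lambda>l. \<sigma>' (\<sigma>' 1 + i * n + l) \<noteq> 0) [0..<n] | i. i < n}"
      unfolding output_set_def using \<sigma>0 by (simp add: \<sigma>'_def)
    have "output_set n (\<sigma>(Suc 0 := 40)) = {bit_row n B i | i. i < n}"
      unfolding \<sigma>'_def [symmetric] out by (rule Collect_cong) (metis row)
    then show ?thesis using generate_rows[OF sub, of B] B(2) by (simp add: reduced_def)
  qed
  show ?thesis
    unfolding simon_prog_def
    apply (rule wp_block[OF wp_setup_prog[OF assms], where ?T2.0 = "3 + (n * (round_time + 3) + 2)"])
    subgoal by (simp add: total_time_def)
    subgoal for \<sigma>1 \<psi>1
      apply (elim conjE)
      apply (simp only: append.simps)
      apply (rule wp_Const, simp)
      apply (rule wp_Move, simp)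
      apply (rule wp_Move, simp)
      apply (rule wp_Loop_upto[where b = "round_time + 2" and T' = 1 and
          I = "\<lambda>k \<sigma> \<psi>. \<exists>j. j + k = n \<and> round_inv j \<sigma> \<psi> \<and> \<sigma> 6 = w + j"])
      subgoal for k \<sigma> \<psi>
        apply (elim conjE exE)
        subgoal for j
          apply (rule wp_block[OF wp_round_prog[of j], where ?T2.0 = 2])
          subgoal by simp
          subgoal by simp
          subgoal by simp
          subgoal by simp
          subgoal for \<sigma>' \<psi>'
            apply (elim conjE)
            apply (rule wp_Inc, simp)
            apply (rule wp_Dec, simp)
            apply (rule wp_Nil)
            by (auto simp: round_inv_def env_def stored_def intro!: exI[of _ "Suc j"])
          done
        done
      subgoal
        using vac reduced_0
        by (auto simp: round_inv_def env_def stored_def intro!: exI[of _ "\<lambda>i l. i = l"])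
      subgoal by (simp add: env_def algebra_simps)
      subgoal
        apply (rule wp_Const, simp)
        apply (rule wp_Nil)
        using finish by auto
      done
    done
qed

text \<open>\<open>circuit_size\<close> bounds \<open>w\<close> and hence \<open>n\<close> and
  \<open>m\<close>. The cubic order comes from \<open>n\<close> rounds that each scan the
  \<open>n * n\<close> matrix; the coefficients are not optimized.\<close>

lemma total_time_le:
  assumes "circuit_size w C \<le> N"
  shows "total_time \<le> 114 * (N + 1) ^ 3"
proof -
  have nmw: "n \<le> N" "m \<le> N" "w \<le> N" using layout assms by (auto simp: circuit_size_def)
  have sq: "n * n \<le> N * N" using nmw by (intro mult_mono) auto
  have q: "query_time \<le> 17 * ((N + 1) * (N + 1))"
    using nmw sq assms by (simp add: query_time_def algebra_simps)
  have r: "round_time \<le> 103 * ((N + 1) * (N + 1))"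
    using nmw sq q by (simp add: round_time_def algebra_simps)
  have "n * round_time \<le> N * (103 * ((N + 1) * (N + 1)))"
    using nmw r by (intro mult_mono) auto
  then have "total_time \<le> N * (103 * ((N + 1) * (N + 1))) + 4 * (N * N) + 10 * N + 11"
    using nmw sq by (simp add: total_time_def algebra_simps)
  also have "\<dots> \<le> 114 * ((N + 1) * (N + 1) * (N + 1))" by (simp add: algebra_simps)
  finally show ?thesis by (simp add: power3_eq_cube)
qed

end

section \<open>Transfer to the machine model and to Simon's promise\<close>

lemma (in machine) exact_in_time_wp:
  assumes "wp A T (\<lambda>\<sigma> \<psi>. correct (output_set n \<sigma>)) ((\<lambda>_. 0)(0 := n, 1 := m, 2 := w)) (ket {})"
    and "T \<le> T'"
  shows "exact_in_time A w C n m T' correct"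
proof -
  let ?\<Phi> = "\<lambda>c. prog c = [] \<and> correct (output_set n (mem c))"
  have "wp A T' (\<lambda>\<sigma> \<psi>. correct (output_set n \<sigma>)) ((\<lambda>_. 0)(0 := n, 1 := m, 2 := w)) (ket {})"
    by (rule wp_mono[OF assms])
  from this[unfolded wp_def, rule_format, of 0 "[]"]
  have reach: "reaches T' ?\<Phi> (init A n m w)" by (simp add: init_def)
  have "?\<Phi> c \<and> clock c \<le> T'" if "c \<in> set_pmf (run w C T' (init A n m w))" for c
    by (rule reaches_run[OF reach _ that]) (simp_all add: init_def)
  then show ?thesis
    unfolding exact_in_time_def by (auto simp: measure_pmf_zero_iff)
qed

text \<open>Every element is its own inverse, so \<open>x\<close> lies in the coset of
  \<open>y\<close> iff their sum lies in \<open>H\<close>; distinctness across cosets and constancy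
  on them give the two directions.\<close>

lemma simon_promise_iff:
  assumes promise: "simon_promise n H \<rho>" and x: "length x = n" and y: "length y = n"
  shows "\<rho> x = \<rho> y \<longleftrightarrow> map2 (\<noteq>) x y \<in> H"
proof -
  interpret group "Z2 n" by (rule group_Z2)
  note pr = promise[unfolded simon_promise_def]
  have sub: "subgroup H (Z2 n)" by (rule pr[THEN conjunct1])
  have const_on: "\<forall>K \<in> rcosets\<^bsub>Z2 n\<^esub> H. \<forall>x \<in> K. \<forall>y \<in> K. \<rho> x = \<rho> y"
    by (rule pr[THEN conjunct2, THEN conjunct1])
  have distinct: "\<forall>K \<in> rcosets\<^bsub>Z2 n\<^esub> H. \<forall>L \<in> rcosets\<^bsub>Z2 n\<^esub> H.
        K \<noteq> L \<longrightarrow> (\<forall>x \<in> K. \<forall>y \<in> L. \<rho> x \<noteq> \<rho> y)"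
    by (rule pr[THEN conjunct2, THEN conjunct2])
  have car: "x \<in> carrier (Z2 n)" "y \<in> carrier (Z2 n)" using x y by (auto simp: Z2_def)
  have cos: "H #>\<^bsub>Z2 n\<^esub> z \<in> rcosets\<^bsub>Z2 n\<^esub> H" "z \<in> H #>\<^bsub>Z2 n\<^esub> z" if "z \<in> carrier (Z2 n)" for z
    using that sub subgroup.subset[OF sub] by (auto intro: rcosetsI rcos_self)
  have xor: "map2 (\<noteq>) (map2 (\<noteq>) u v) v = u" if "length u = n" "length v = n" for u v
    using that by (auto intro!: nth_equalityI)
  have mem: "x \<in> H #>\<^bsub>Z2 n\<^esub> y \<longleftrightarrow> map2 (\<noteq>) x y \<in> H"
  proof
    assume "x \<in> H #>\<^bsub>Z2 n\<^esub> y"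
    then obtain h where h: "h \<in> H" "x = map2 (\<noteq>) h y" by (auto simp: r_coset_def Z2_def)
    moreover have "length h = n" using h subgroup.subset[OF sub] by (auto simp: Z2_def)
    ultimately show "map2 (\<noteq>) x y \<in> H" using xor[of h y] y by simp
  next
    assume "map2 (\<noteq>) x y \<in> H"
    moreover have "x = map2 (\<noteq>) (map2 (\<noteq>) x y) y" using xor x y by simp
    ultimately show "x \<in> H #>\<^bsub>Z2 n\<^esub> y" unfolding r_coset_def Z2_def by force
  qed
  show ?thesis
  proof
    assume eq: "\<rho> x = \<rho> y"
    have "H #>\<^bsub>Z2 n\<^esub> x = H #>\<^bsub>Z2 n\<^esub> y"
    proof (rule ccontr)
      assume "H #>\<^bsub>Z2 n\<^esub> x \<noteq> H #>\<^bsub>Z2 n\<^esub> y"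
      then have "\<rho> x \<noteq> \<rho> y"
        using distinct[rule_format, OF cos(1)[OF car(1)] cos(1)[OF car(2)] _ cos(2)[OF car(1)] cos(2)[OF car(2)]]
        by simp
      with eq show False by simp
    qed
    then show "map2 (\<noteq>) x y \<in> H" using cos(2)[OF car(1)] mem by simp
  next
    assume "map2 (\<noteq>) x y \<in> H"
    then have "x \<in> H #>\<^bsub>Z2 n\<^esub> y" by (simp only: mem)
    then show "\<rho> x = \<rho> y"
      using const_on[rule_format, OF cos(1)[OF car(2)] _ cos(2)[OF car(2)]] by simp
  qed
qed

text \<open>\<open>enc\<close> is injective on \<open>R\<close>, so the encoded function separates
  the same cosets as \<rho>, and the analysis for bit strings applies.\<close>

lemma simon_prog_exact:
  assumes \<rho>: "\<rho> \<in> carrier (Z2 n) \<rightarrow> R" and promise: "simon_promise n H \<rho>"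
    and enc: "inj_on enc R" "enc \<in> R \<rightarrow> {b. length b = m}"
    and comp: "computes \<G> w C n m (\<lambda>x. enc (\<rho> x))"
    and size: "circuit_size w C \<le> N"
  shows "exact_in_time simon_prog w C n m (114 * (N + 1) ^ 3) (\<lambda>S. generate (Z2 n) S = H)"
proof -
  have R: "\<rho> x \<in> R" if "length x = n" for x
    using funcset_mem[OF \<rho>, of x] that by (simp add: Z2_def)
  have len: "length (enc (\<rho> x)) = m" if "length x = n" for x
    using funcset_mem[OF enc(2) R[OF that]] by simp
  have layout: "n + m \<le> w" using comp by (simp add: computes_def)
  interpret simon_machine w C n m H "\<lambda>x. enc (\<rho> x)"
  proof (intro simon_machine.intro layout.intro simon_round.intro simon_machine_axioms.intro)
    show "subgroup H (Z2 n)" using promise by (simp add: simon_promise_def)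
    show "enc (\<rho> x) = enc (\<rho> y) \<longleftrightarrow> map2 (\<noteq>) x y \<in> H" if "length x = n" "length y = n" for x y
      using simon_promise_iff[OF promise that] inj_on_eq_iff[OF enc(1) R R] that by simp
    show "run_circuit C \<psi> = \<psi> \<circ> query n m (\<lambda>x. enc (\<rho> x))"
      if "\<And>s. \<psi> s \<noteq> 0 \<Longrightarrow> s \<inter> {n + m..<w} = {}" for \<psi>
      by (rule run_circuit_query[OF comp len that])
  qed (use layout len in auto)
  show ?thesis
    by (rule exact_in_time_wp[OF wp_simon_prog[OF refl] total_time_le[OF size]])
qed

theorem theorem5:
  shows "\<exists>A :: instr list. \<forall>(\<G> :: complex mat set) (q :: nat poly).
    elementary_gates \<G> \<longrightarrow>
    (\<exists>p :: nat poly.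
      \<forall>(n :: nat) (H\<^sub>0 :: bool list set) (R :: 'r set) (\<rho> :: bool list \<Rightarrow> 'r)
        (m :: nat) (enc :: 'r \<Rightarrow> bool list) (w :: nat) (C :: circuit).
        n \<ge> 1 \<longrightarrow>
        \<rho> \<in> carrier (Z2 n) \<rightarrow> R \<longrightarrow>
        simon_promise n H\<^sub>0 \<rho> \<longrightarrow>
        inj_on enc R \<and> enc \<in> R \<rightarrow> {b. length b = m} \<longrightarrow>
        computes \<G> w C n m (\<lambda>x. enc (\<rho> x)) \<longrightarrow>
        circuit_size w C \<le> poly q n \<longrightarrow>
        exact_in_time A w C n m (poly p n) (\<lambda>S. generate (Z2 n) S = H\<^sub>0))"
proof (intro exI[of _ simon_prog] allI impI)
  fix \<G> :: "complex mat set" and q :: "nat poly"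
  show "\<exists>p :: nat poly.
      \<forall>(n :: nat) (H\<^sub>0 :: bool list set) (R :: 'r set) (\<rho> :: bool list \<Rightarrow> 'r)
        (m :: nat) (enc :: 'r \<Rightarrow> bool list) (w :: nat) (C :: circuit).
        n \<ge> 1 \<longrightarrow>
        \<rho> \<in> carrier (Z2 n) \<rightarrow> R \<longrightarrow>
        simon_promise n H\<^sub>0 \<rho> \<longrightarrow>
        inj_on enc R \<and> enc \<in> R \<rightarrow> {b. length b = m} \<longrightarrow>
        computes \<G> w C n m (\<lambda>x. enc (\<rho> x)) \<longrightarrow>
        circuit_size w C \<le> poly q n \<longrightarrow>
        exact_in_time simon_prog w C n m (poly p n) (\<lambda>S. generate (Z2 n) S = H\<^sub>0)"
  \<comment> \<open>The bound of \<open>simon_prog_exact\<close> at \<open>N = poly q n\<close>. The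
    program is fixed before \<open>q\<close>, so only the time bound depends on
    \<open>q\<close>.\<close>
  proof (intro exI[of _ "[:114:] * (q + 1) ^ 3"] allI impI)
    fix n :: nat and H\<^sub>0 :: "bool list set" and R :: "'r set" and \<rho> :: "bool list \<Rightarrow> 'r"
      and m :: nat and enc :: "'r \<Rightarrow> bool list" and w :: nat and C :: circuit
    assume "\<rho> \<in> carrier (Z2 n) \<rightarrow> R" "simon_promise n H\<^sub>0 \<rho>"
      and "inj_on enc R \<and> enc \<in> R \<rightarrow> {b. length b = m}"
      and "computes \<G> w C n m (\<lambda>x. enc (\<rho> x))" "circuit_size w C \<le> poly q n"
    then have "exact_in_time simon_prog w C n m (114 * (poly q n + 1) ^ 3) (\<lambda>S. generate (Z2 n) S = H\<^sub>0)"
      by (intro simon_prog_exact[where \<rho> = \<rho> and R = R and enc = enc and \<G> = \<G>]) auto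
    then show "exact_in_time simon_prog w C n m (poly ([:114:] * (q + 1) ^ 3) n)
        (\<lambda>S. generate (Z2 n) S = H\<^sub>0)"
      by (simp add: poly_power)
  qed
qed

end
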